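(* For $|z_4|$ sufficiently large (and any fixed branch of $\log z_4$), the limits $\tilde\Phi=\lim_{\varepsilon\to0}\Phi_\varepsilon Q$ and $\tilde\Phi^\vee=\lim_{\varepsilon\to0}\Phi^\vee_\varepsilon Q$ of the row vectors defined in the context exist, and $$\tilde\Phi\begin{pmatrix}4\pi^3&0&0&\pi\\0&0&\pi&0\\0&\pi&0&0\\\pi&0&0&0\end{pmatrix}{}^t\tilde\Phi^\vee=64.$$
   Context: For $\varepsilon\in\mathbb{C}$ near $0$, $\varepsilon\ne0$, define the series in $z_4$ (GKZ series restricted to $z_1=z_2=z_3=z_5=1$, attached to the matrix with columns $(1,3,0)^t,(1,2,1)^t,(1,2,-1)^t,(1,2,0)^t,(1,1,0)^t$ and parameter $c(\varepsilon)=(1/2,1+\varepsilon,\varepsilon)^t$, resp. $-c(\varepsilon)$; $1/\Gamma$ is the entire reciprocal Gamma function): $$\varphi_{345}(c(\varepsilon))=z_4^{-\frac12-2\varepsilon}\sum_{m,n\ge0}\frac{z_4^{-2(m+n)}}{\Gamma(1+\varepsilon+n)\Gamma(\frac12-2\varepsilon-2m-2n)\Gamma(1+\varepsilon+m)\,m!\,n!},$$ $$\varphi_{245}(c(\varepsilon))=\varphi_{134}(c(\varepsilon))=z_4^{-\frac12}\sum_{m,n\ge0}\frac{z_4^{-2(m+n)}}{\Gamma(1-\varepsilon+n)\Gamma(\frac12-2m-2n)\Gamma(1+\varepsilon+m)\,m!\,n!},$$ $$\varphi_{124}(c(\varepsilon))=z_4^{-\frac12+2\varepsilon}\sum_{m,n\ge0}\frac{z_4^{-2(m+n)}}{\Gamma(1-\varepsilon+n)\Gamma(\frac12+2\varepsilon-2m-2n)\Gamma(1-\varepsilon+m)\,m!\,n!},$$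 $$\varphi_{345}(-c(\varepsilon))=z_4^{\frac12+2\varepsilon}\sum_{m,n\ge0}\frac{z_4^{-2(m+n)}}{\Gamma(1-\varepsilon+n)\Gamma(\frac32+2\varepsilon-2m-2n)\Gamma(1-\varepsilon+m)\,m!\,n!},$$ $$\varphi_{245}(-c(\varepsilon))=\varphi_{134}(-c(\varepsilon))=z_4^{\frac12}\sum_{m,n\ge0}\frac{z_4^{-2(m+n)}}{\Gamma(1+\varepsilon+n)\Gamma(\frac32-2m-2n)\Gamma(1-\varepsilon+m)\,m!\,n!},$$ $$\varphi_{124}(-c(\varepsilon))=z_4^{\frac12-2\varepsilon}\sum_{m,n\ge0}\frac{z_4^{-2(m+n)}}{\Gamma(1+\varepsilon+n)\Gamma(\frac32-2\varepsilon-2m-2n)\Gamma(1+\varepsilon+m)\,m!\,n!}.$$ Put $\Phi_\varepsilon=(\varphi_{345}(c(\varepsilon)),\varphi_{245}(c(\varepsilon)),\varphi_{134}(c(\varepsilon)),\varphi_{124}(c(\varepsilon)))$, $\Phi^\vee_\varepsilon=(\varphi_{345}(-c(\varepsilon)),\varphi_{245}(-c(\varepsilon)),\varphi_{134}(-c(\varepsilon)),\varphi_{124}(-c(\varepsilon)))$ and $$Q=\begin{pmatrix}1&-\varepsilon^{-1}&-\varepsilon^{-1}&\varepsilon^{-2}\\0&\varepsilon^{-1}&0&-\varepsilon^{-2}\\0&0&\varepsilon^{-1}&-\varepsilon^{-2}\\0&0&0&\varepsilon^{-2}\end{pmatrix}.$$ *)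

theory Defs
  imports "HOL-Analysis.Analysis"
begin

text \<open>
  A branch of the logarithm at \<open>z\<^sub>4\<close> enters only through its value \<open>L\<close>, a complex number with
  \<open>exp L = z\<^sub>4\<close>; complex powers of \<open>z\<^sub>4\<close> are taken with respect to it.
\<close>

definition branch_power :: "complex \<Rightarrow> complex \<Rightarrow> complex" where
  "branch_power L a = exp (a * L)"

text \<open>
  All the series have the form
  \<open>z\<^sub>4\<^sup>a \<Sum>\<^sub>m\<^sub>,\<^sub>n z\<^sub>4\<^sup>-\<^sup>2\<^sup>(\<^sup>m\<^sup>+\<^sup>n\<^sup>) / (\<Gamma>(1+b+n) \<Gamma>(1+a-2m-2n) \<Gamma>(1+d+m) m! n!)\<close>:
  the argument of the middle Gamma factor is always one plus the exponent of \<open>z\<^sub>4\<close>.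
  The function \<^const>\<open>rGamma\<close> is the entire function \<open>1/\<Gamma>\<close>.
\<close>

definition gkz_term :: "complex \<Rightarrow> complex \<Rightarrow> complex \<Rightarrow> complex \<Rightarrow> nat \<times> nat \<Rightarrow> complex" where
  "gkz_term L a b d = (\<lambda>(m, n).
     branch_power L (- 2 * (of_nat m + of_nat n)) *
     rGamma (1 + b + of_nat n) *
     rGamma (1 + a - 2 * of_nat m - 2 * of_nat n) *
     rGamma (1 + d + of_nat m) / (fact m * fact n))"

definition gkz_series :: "complex \<Rightarrow> complex \<Rightarrow> complex \<Rightarrow> complex \<Rightarrow> complex" where
  "gkz_series L a b d = branch_power L a * (\<Sum>\<^sub>\<infinity>p\<in>UNIV. gkz_term L a b d p)"

text \<open>Suffixes \<open>c\<close> and \<open>mc\<close> stand for the parameters \<open>c(\<epsilon>)\<close> and \<open>-c(\<epsilon>)\<close>.\<close>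

definition phi345_c :: "complex \<Rightarrow> complex \<Rightarrow> complex" where
  "phi345_c L \<epsilon> = gkz_series L (- 1/2 - 2 * \<epsilon>) \<epsilon> \<epsilon>"

definition phi245_c :: "complex \<Rightarrow> complex \<Rightarrow> complex" where
  "phi245_c L \<epsilon> = gkz_series L (- 1/2) (- \<epsilon>) \<epsilon>"

definition phi134_c :: "complex \<Rightarrow> complex \<Rightarrow> complex" where
  "phi134_c L \<epsilon> = phi245_c L \<epsilon>"

definition phi124_c :: "complex \<Rightarrow> complex \<Rightarrow> complex" where
  "phi124_c L \<epsilon> = gkz_series L (- 1/2 + 2 * \<epsilon>) (- \<epsilon>) (- \<epsilon>)"

definition phi345_mc :: "complex \<Rightarrow> complex \<Rightarrow> complex" where
  "phi345_mc L \<epsilon> = gkz_series L (1/2 + 2 * \<epsilon>) (- \<epsilon>) (- \<epsilon>)"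

definition phi245_mc :: "complex \<Rightarrow> complex \<Rightarrow> complex" where
  "phi245_mc L \<epsilon> = gkz_series L (1/2) \<epsilon> (- \<epsilon>)"

definition phi134_mc :: "complex \<Rightarrow> complex \<Rightarrow> complex" where
  "phi134_mc L \<epsilon> = phi245_mc L \<epsilon>"

definition phi124_mc :: "complex \<Rightarrow> complex \<Rightarrow> complex" where
  "phi124_mc L \<epsilon> = gkz_series L (1/2 - 2 * \<epsilon>) \<epsilon> \<epsilon>"

text \<open>
  Convergence of the series involved; needed since an infinite sum that does not converge has the
  value \<open>0\<close> by convention.
\<close>

definition all_series_converge :: "complex \<Rightarrow> complex \<Rightarrow> bool" where
  "all_series_converge L \<epsilon> \<longleftrightarrow>
     gkz_term L (- 1/2 - 2 * \<epsilon>) \<epsilon> \<epsilon> summable_on UNIV \<and>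
     gkz_term L (- 1/2) (- \<epsilon>) \<epsilon> summable_on UNIV \<and>
     gkz_term L (- 1/2 + 2 * \<epsilon>) (- \<epsilon>) (- \<epsilon>) summable_on UNIV \<and>
     gkz_term L (1/2 + 2 * \<epsilon>) (- \<epsilon>) (- \<epsilon>) summable_on UNIV \<and>
     gkz_term L (1/2) \<epsilon> (- \<epsilon>) summable_on UNIV \<and>
     gkz_term L (1/2 - 2 * \<epsilon>) \<epsilon> \<epsilon> summable_on UNIV"

definition Phi :: "complex \<Rightarrow> complex \<Rightarrow> complex ^ 4" where
  "Phi L \<epsilon> = vector [phi345_c L \<epsilon>, phi245_c L \<epsilon>, phi134_c L \<epsilon>, phi124_c L \<epsilon>]"

definition Phi_dual :: "complex \<Rightarrow> complex \<Rightarrow> complex ^ 4" where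
  "Phi_dual L \<epsilon> = vector [phi345_mc L \<epsilon>, phi245_mc L \<epsilon>, phi134_mc L \<epsilon>, phi124_mc L \<epsilon>]"

definition Q :: "complex \<Rightarrow> complex ^ 4 ^ 4" where
  "Q \<epsilon> = vector
     [vector [1, - (1 / \<epsilon>), - (1 / \<epsilon>), 1 / \<epsilon>\<^sup>2],
      vector [0, 1 / \<epsilon>, 0, - (1 / \<epsilon>\<^sup>2)],
      vector [0, 0, 1 / \<epsilon>, - (1 / \<epsilon>\<^sup>2)],
      vector [0, 0, 0, 1 / \<epsilon>\<^sup>2]]"

definition pairing_matrix :: "complex ^ 4 ^ 4" where
  "pairing_matrix = vector
     [vector [4 * of_real pi ^ 3, 0, 0, of_real pi],
      vector [0, 0, of_real pi, 0],
      vector [0, of_real pi, 0, 0],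
      vector [of_real pi, 0, 0, 0]]"

lemma vector_4:
  "(vector [a, b, c, d] :: 'a::zero ^ 4) $ 1 = a"
  "(vector [a, b, c, d] :: 'a::zero ^ 4) $ 2 = b"
  "(vector [a, b, c, d] :: 'a::zero ^ 4) $ 3 = c"
  "(vector [a, b, c, d] :: 'a::zero ^ 4) $ 4 = d"
  by (simp_all add: vector_def)

end

theory Submission
  imports Defs "HOL-Complex_Analysis.Complex_Analysis"
begin

text \<open>
  Put \<open>F(s,t) = z\<^sup>a\<^sup>-\<^sup>s\<^sup>-\<^sup>t \<Sum>\<^sub>m\<^sub>,\<^sub>n \<dots>\<close> with \<open>a = \<plusminus>1/2\<close>; the entries of the two row vectors are
  \<open>F(\<plusminus>\<epsilon>,\<plusminus>\<epsilon>)\<close>, so the limits are \<open>F\<close>, \<open>\<mp>2 F\<^sub>s\<close> and \<open>4 F\<^sub>s\<^sub>t\<close> at the origin.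
  By the Vandermonde identity the part \<open>m + n = N\<close> of the double sum is a product of Gamma factors.
  Only jets modulo \<open>s\<^sup>2, t\<^sup>2\<close> matter, and these depend on \<open>\<tau> = (s+t)/2\<close> modulo \<open>\<tau>\<^sup>3\<close> alone: they are the
  jets of one hypergeometric series in \<open>y = 16/z\<^sup>2\<close> annihilated, with \<open>\<theta> = y d/dy + \<tau>\<close>, by
  \<open>\<theta>\<^sup>3 - y (\<theta>\<^sup>2 - 1/16)(\<theta> + 1/2)\<close>. This operator has an invariant quadratic form on its solutions, whose
  value is forced to be constant in \<open>y\<close> and is read off at \<open>y = 0\<close> with the reflection formula for Gamma.
  The series for \<open>a = -1/2\<close> is the \<open>z\<close>-derivative of the one for \<open>a = 1/2\<close>, so the pairing of
  the two limits is a derivative of this quadratic form.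
\<close>

subsection \<open>Jets of formal solutions of the differential equation\<close>

text \<open>
  A sequence of power series in \<open>\<tau>\<close> is read as a power series in \<open>y\<close> whose coefficients are jets at
  \<open>\<tau> = 0\<close>; \<open>col k\<close> extracts the coefficient of \<open>\<tau>\<^sup>k\<close>, a power series in \<open>y\<close>.
\<close>

definition col :: "nat \<Rightarrow> (nat \<Rightarrow> complex fps) \<Rightarrow> complex fps" where
  "col k v = Abs_fps (\<lambda>N. fps_nth (v N) k)"

text \<open>With the factor \<open>y^\<tau>\<close> split off, \<open>y d/dy\<close> multiplies the
  coefficient of \<open>y^N\<close> by \<open>N + \<tau>\<close>, and \<open>fps_X\<close> is the
  variable \<open>\<tau>\<close>.\<close>

definition theta :: "(nat \<Rightarrow> complex fps) \<Rightarrow> nat \<Rightarrow> complex fps" where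
  "theta v N = (of_nat N + fps_X) * v N"

text \<open>
  The main part is the coefficient of \<open>\<tau>\<^sup>2\<close> in \<open>v(\<tau>) w(-\<tau>)\<close>; the sign makes the logarithms cancel and
  \<open>theta\<close> a derivation for the form.
\<close>

definition jet_form :: "complex \<Rightarrow> (nat \<Rightarrow> complex fps) \<Rightarrow> (nat \<Rightarrow> complex fps) \<Rightarrow> complex fps" where
  "jet_form \<kappa> v w = col 0 v * col 2 w - col 1 v * col 1 w + col 2 v * col 0 w
     + fps_const \<kappa> * (col 0 v * col 0 w)"

lemma fps_nth_col [simp]: "fps_nth (col k v) N = fps_nth (v N) k"
  by (simp add: col_def)

lemma fps_nth_of_nat_mult: "fps_nth (of_nat n * f) k = of_nat n * fps_nth (f :: 'a :: comm_ring_1 fps) k"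
  by (simp add: fps_of_nat[symmetric])

lemma col_0_theta: "col 0 (theta v) = fps_XD (col 0 v)"
  by (rule fps_ext) (simp add: theta_def algebra_simps fps_nth_of_nat_mult)

lemma col_Suc_theta: "col (Suc k) (theta v) = fps_XD (col (Suc k) v) + col k v"
  by (rule fps_ext) (simp add: theta_def distrib_right fps_nth_of_nat_mult)

lemma fps_XD_mult: "fps_XD (f * g) = fps_XD f * g + f * fps_XD (g :: 'a :: comm_ring_1 fps)"
  by (simp add: fps_XD_def algebra_simps)

lemma jet_form_commute: "jet_form \<kappa> v w = jet_form \<kappa> w v"
  by (simp add: jet_form_def algebra_simps)

lemma fps_XD_diff: "fps_XD (f - g) = fps_XD f - fps_XD (g :: 'a :: comm_ring_1 fps)"
  by (simp add: fps_XD_def algebra_simps)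

lemma fps_XD_const: "fps_XD (fps_const (c :: 'a :: comm_ring_1)) = 0"
  by (simp add: fps_XD_def)

text \<open>\<open>theta\<close> adds \<open>col (k-1)\<close> to \<open>col k\<close>. The terms
  \<open>col 0 v * col 1 w - col 1 v * col 0 w\<close> so produced arise from the two arguments with
  opposite signs and cancel, which leaves the Leibniz rule for \<open>y d/dy\<close>.\<close>

lemma fps_XD_jet_form:
  "fps_XD (jet_form \<kappa> v w) = jet_form \<kappa> (theta v) w + jet_form \<kappa> v (theta w)"
proof -
  have c: "col 1 (theta v) = fps_XD (col 1 v) + col 0 v" 
          "col 2 (theta v) = fps_XD (col 2 v) + col 1 v" for v
    using col_Suc_theta[of 0 v] col_Suc_theta[of 1 v] by (simp_all add: numeral_2_eq_2)
  show ?thesis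
    unfolding jet_form_def c col_0_theta fps_XD_mult_const fps_XD_mult fps_XD_add fps_XD_diff
    by (simp add: fps_XD_const algebra_simps)
qed

text \<open>
  The unknown \<open>tij\<close> stands for the form evaluated at the \<open>i\<close>-th and \<open>j\<close>-th \<open>theta\<close>-derivatives. At level
  \<open>y\<^sup>n\<close> the system is \<open>n\<close> minus a nilpotent matrix, hence invertible for \<open>n > 0\<close>.
\<close>

lemma homogeneous_jet_system_unique:
  fixes t00 t01 t02 t03 t11 t12 t13 t22 t23 :: "complex fps"
  assumes XD: "fps_XD t00 = 2 * t01" "fps_XD t01 = t11 + t02" "fps_XD t11 = 2 * t12"
      "fps_XD t02 = t12 + t03" "fps_XD t12 = t22 + t13" "fps_XD t22 = 2 * t23"
    and rec: "t03 = fps_X * (t03 + fps_const a * t02 + fps_const b * t01 + fps_const c * t00)"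
      "t13 = fps_X * (t13 + fps_const a * t12 + fps_const b * t11 + fps_const c * t01)"
      "t23 = fps_X * (t23 + fps_const a * t22 + fps_const b * t12 + fps_const c * t02)"
    and init: "fps_nth t00 0 = 0" "fps_nth t01 0 = 0" "fps_nth t02 0 = 0"
      "fps_nth t11 0 = 0" "fps_nth t12 0 = 0" "fps_nth t22 0 = 0"
  shows "t00 = 0 \<and> t01 = 0"
proof -
  have two: "fps_nth (2 * f) n = 2 * fps_nth f n" for f :: "complex fps" and n
    by (metis fps_mult_left_const_nth numeral_fps_const)
  have "fps_nth t00 n = 0 \<and> fps_nth t01 n = 0 \<and> fps_nth t02 n = 0 \<and> fps_nth t03 n = 0 \<and>
        fps_nth t11 n = 0 \<and> fps_nth t12 n = 0 \<and> fps_nth t13 n = 0 \<and> fps_nth t22 n = 0 \<and>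
        fps_nth t23 n = 0" for n
  proof (induction n)
    case 0
    show ?case
      using arg_cong[OF rec(1), of "\<lambda>f. fps_nth f 0"] arg_cong[OF rec(2), of "\<lambda>f. fps_nth f 0"]
        arg_cong[OF rec(3), of "\<lambda>f. fps_nth f 0"] init by simp
  next
    case (Suc n)
    \<comment> \<open>The right-hand sides of \<open>rec\<close> carry a factor \<open>y\<close>, so
      they only involve level \<open>n\<close>.\<close>
    have r: "fps_nth t03 (Suc n) = 0" "fps_nth t13 (Suc n) = 0" "fps_nth t23 (Suc n) = 0"
      by (subst rec, use Suc in simp)+
    \<comment> \<open>Back substitution divides by \<open>Suc n\<close> and clears
      \<open>t22\<close>, \<open>t12\<close>, \<open>t11\<close> and \<open>t02\<close>,
      \<open>t01\<close>, \<open>t00\<close> in this order.\<close>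
    have e: "of_nat (Suc n) * fps_nth t00 (Suc n) = 2 * fps_nth t01 (Suc n)"
       "of_nat (Suc n) * fps_nth t01 (Suc n) = fps_nth t11 (Suc n) + fps_nth t02 (Suc n)"
       "of_nat (Suc n) * fps_nth t11 (Suc n) = 2 * fps_nth t12 (Suc n)"
       "of_nat (Suc n) * fps_nth t02 (Suc n) = fps_nth t12 (Suc n) + fps_nth t03 (Suc n)"
       "of_nat (Suc n) * fps_nth t12 (Suc n) = fps_nth t22 (Suc n) + fps_nth t13 (Suc n)"
       "of_nat (Suc n) * fps_nth t22 (Suc n) = 2 * fps_nth t23 (Suc n)"
      using XD[THEN arg_cong, of "\<lambda>f. fps_nth f (Suc n)"] 
      by (simp_all only: fps_XD_nth two fps_add_nth)
    have nz: "of_nat (Suc n) \<noteq> (0 :: complex)" by (simp del: of_nat_Suc)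
    show ?case
      using e r nz by (simp del: of_nat_Suc)
  qed
  thus ?thesis by (simp add: fps_eq_iff)
qed

text \<open>The recursion expresses the third \<open>theta\<close>-derivative of \<open>u\<close>
  through the lower ones, so the values of the form on these derivatives satisfy a closed linear
  system in \<open>y\<close>. Its solution is determined by the constant terms, which
  \<open>init0\<close> and \<open>init2\<close> supply.\<close>

lemma jet_form_eq_const:
  fixes u :: "nat \<Rightarrow> complex fps"
  assumes rec: "\<And>N. (of_nat (Suc N) + fps_X) ^ 3 * u (Suc N) =
      ((of_nat N + fps_X) ^ 2 - fps_const (1/16)) * (of_nat N + fps_X + fps_const (1/2)) * u N"
    and init0: "(fps_nth (u 0) 0)\<^sup>2 = e"
    and init2: "2 * fps_nth (u 0) 0 * fps_nth (u 0) 2 - (fps_nth (u 0) 1)\<^sup>2 = (16 - \<kappa>) * e"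
  shows "jet_form \<kappa> u u = fps_const (16 * e)" and "jet_form \<kappa> u (theta u) = 0"
proof -
  define u1 where "u1 = theta u"
  define u2 where "u2 = theta u1"
  define u3 where "u3 = theta u2"
  \<comment> \<open>This is \<open>(\<theta>^2 - 1/16)(\<theta> + 1/2)\<close> applied to
    \<open>u\<close>, multiplied out.\<close>
  define r where "r = (\<lambda>N. u3 N + fps_const (1/2) * u2 N - fps_const (1/16) * u1 N - fps_const (1/32) * u N)"
  have u3: "u3 N = (of_nat N + fps_X) ^ 3 * u N" for N
    by (simp add: u3_def u2_def u1_def theta_def power3_eq_cube mult_ac)
  have r: "u3 (Suc N) = r N" for N
    unfolding u3 rec
    by (simp add: u3_def u2_def u1_def theta_def r_def power2_eq_square algebra_simps fps_const_mult[symmetric] del: fps_const_mult)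
  \<comment> \<open>At level \<open>0\<close> the jet \<open>u3 0\<close> equals
    \<open>\<tau>^3 * u 0\<close> and has no coefficient below \<open>\<tau>^3\<close>. The
    restriction \<open>k < 3\<close> covers exactly the columns that enter the form.\<close>
  have col_u3: "col k u3 = fps_X * (col k u3 + fps_const (1/2) * col k u2 + fps_const (-1/16) * col k u1
      + fps_const (-1/32) * col k u)" if "k < 3" for k
  proof (rule fps_ext)
    fix n
    show "fps_nth (col k u3) n = fps_nth (fps_X * (col k u3 + fps_const (1/2) * col k u2 + fps_const (-1/16) * col k u1
      + fps_const (-1/32) * col k u)) n"
    proof (cases n)
      case 0
      thus ?thesis using that by (simp add: u3 fps_X_power_mult_nth)
    next
      case (Suc m)
      thus ?thesis by (simp add: r) (simp add: r_def)
    qed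
  qed
  define T where "T = jet_form \<kappa>"
  have T_u3: "T v u3 = fps_X * (T v u3 + fps_const (1/2) * T v u2 + fps_const (-1/16) * T v u1
      + fps_const (-1/32) * T v u)" for v
  proof -
    have "T v u3 = col 0 v * (fps_X * (col 2 u3 + fps_const (1/2) * col 2 u2 + fps_const (-1/16) * col 2 u1
      + fps_const (-1/32) * col 2 u)) - col 1 v * (fps_X * (col 1 u3 + fps_const (1/2) * col 1 u2 + fps_const (-1/16) * col 1 u1
      + fps_const (-1/32) * col 1 u)) + (col 2 v + fps_const \<kappa> * col 0 v) * (fps_X * (col 0 u3 + fps_const (1/2) * col 0 u2 + fps_const (-1/16) * col 0 u1
      + fps_const (-1/32) * col 0 u))"
      using col_u3[of 0] col_u3[of 1] col_u3[of 2]
      by (simp add: T_def jet_form_def distrib_right mult.assoc)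
    also have "\<dots> = fps_X * (T v u3 + fps_const (1/2) * T v u2 + fps_const (-1/16) * T v u1
      + fps_const (-1/32) * T v u)"
      unfolding T_def jet_form_def by (simp only: algebra_simps)
    finally show ?thesis .
  qed
  have T_comm: "T v w = T w v" for v w
    by (simp add: T_def jet_form_commute)
  have XD_T: "fps_XD (T v w) = T (theta v) w + T v (theta w)" for v w
    by (simp add: T_def fps_XD_jet_form)
  \<comment> \<open>\<open>J\<close> is \<open>1/(1-y)\<close>, the singular factor in the explicit
    solution below.\<close>
  define J :: "complex fps" where "J = Abs_fps (\<lambda>_. 1)"
  have J: "(1 - fps_X) * J = 1"
    by (rule fps_ext) (auto simp: J_def algebra_simps fps_X_mult_nth)
  hence J1: "J = fps_X * J + 1"
    by (simp add: algebra_simps)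
  have J2: "J * J = fps_X * (J * J) + J"
    using arg_cong[OF J1, of "\<lambda>x. x * J"] by (simp add: algebra_simps)
  have XDJ: "fps_XD (fps_X * J) = fps_X * (J * J)"
  proof -
    have "fps_deriv J = J * J"
    proof -
      have "(1 - fps_X) * fps_deriv J = J"
        using arg_cong[OF J, of fps_deriv] by (simp add: algebra_simps)
      moreover have "(1 - fps_X) * (fps_deriv J - J * J) = (1 - fps_X) * fps_deriv J - ((1 - fps_X) * J) * J"
        by (simp only: algebra_simps)
      ultimately have "(1 - fps_X) * (fps_deriv J - J * J) = 0"
        using J by simp
      moreover have "(1 - fps_X :: complex fps) \<noteq> 0"
        using J by auto
      ultimately show ?thesis by simp
    qed
    thus ?thesis
      using J2 by (simp add: fps_XD_def algebra_simps)
  qed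
  have init: "u1 0 $ 0 = 0" "u2 0 $ 0 = 0" "u1 0 $ Suc 0 = u 0 $ 0" "u1 0 $ 2 = u 0 $ 1"
    "u2 0 $ Suc 0 = 0" "u2 0 $ 2 = u 0 $ 0"
    by (simp_all add: u1_def u2_def theta_def numeral_2_eq_2)
  \<comment> \<open>Subtract the explicit solution \<open>T00 = 16e\<close>, \<open>T01 = T12 = 0\<close>, \<open>T02 = -T11 = e\<close>,
    \<open>T13 = -T22 = e/16 \<cdot> y/(1-y)\<close>, \<open>T23 = -e/32 \<cdot> y/(1-y)\<^sup>2\<close> of the system.\<close>
  have T: "T u u - fps_const (16 * e) = 0 \<and> T u u1 = 0"
  proof (rule homogeneous_jet_system_unique[where a = "1/2" and b = "-1/16" and c = "-1/32"
        and ?t11.0 = "T u1 u1 + fps_const e" and ?t02.0 = "T u u2 - fps_const e"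
        and ?t12.0 = "T u1 u2" and ?t03.0 = "T u u3" and ?t13.0 = "T u1 u3 - fps_const (e/16) * (fps_X * J)"
        and ?t22.0 = "T u2 u2 + fps_const (e/16) * (fps_X * J)"
        and ?t23.0 = "T u2 u3 + fps_const (e/32) * (fps_X * (J * J))"])
    show "fps_XD (T u u - fps_const (16 * e)) = 2 * T u u1"
      by (simp add: XD_T fps_XD_diff fps_XD_const T_comm[of u1 u] u1_def[symmetric])
    show "fps_XD (T u u1) = T u1 u1 + fps_const e + (T u u2 - fps_const e)"
      by (simp add: XD_T u1_def[symmetric] u2_def[symmetric])
    show "fps_XD (T u1 u1 + fps_const e) = 2 * T u1 u2"
      by (simp add: XD_T fps_XD_const T_comm[of u2 u1] u2_def[symmetric])
    show "fps_XD (T u u2 - fps_const e) = T u1 u2 + T u u3"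
      by (simp add: XD_T fps_XD_diff fps_XD_const u1_def[symmetric] u3_def[symmetric])
    show "fps_XD (T u1 u2) = T u2 u2 + fps_const (e/16) * (fps_X * J) + (T u1 u3 - fps_const (e/16) * (fps_X * J))"
      by (simp add: XD_T u2_def[symmetric] u3_def[symmetric])
    have "2 * (fps_const (e/32) * z) = fps_const (e/16) * z" for z
      by (simp add: numeral_fps_const mult.assoc[symmetric])
    thus "fps_XD (T u2 u2 + fps_const (e/16) * (fps_X * J)) = 2 * (T u2 u3 + fps_const (e/32) * (fps_X * (J * J)))"
      by (simp add: XD_T XDJ T_comm[of u3 u2] u3_def[symmetric] distrib_left)
    show "T u u3 = fps_X * (T u u3 + fps_const (1/2) * (T u u2 - fps_const e)
        + fps_const (-1/16) * T u u1 + fps_const (-1/32) * (T u u - fps_const (16 * e)))"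
      by (subst T_u3) (simp add: right_diff_distrib)
    show "T u1 u3 - fps_const (e/16) * (fps_X * J) =
      fps_X * (T u1 u3 - fps_const (e/16) * (fps_X * J) + fps_const (1/2) * T u1 u2
        + fps_const (-1/16) * (T u1 u1 + fps_const e) + fps_const (-1/32) * T u u1)"
    proof -
      have "fps_const (e/16) * (fps_X * J) = fps_X * (fps_const (e/16) * (fps_X * J) + fps_const (e/16))"
        by (subst J1) (simp add: algebra_simps)
      moreover have B: "fps_const (-1/16) * (T u1 u1 + fps_const e) = fps_const (-1/16) * T u1 u1 - fps_const (e/16)"
        by (simp add: distrib_left)
      ultimately show ?thesis
        using T_u3[of u1] unfolding B T_comm[of u1 u] by algebra
    qed
    show "T u2 u3 + fps_const (e/32) * (fps_X * (J * J)) =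
      fps_X * (T u2 u3 + fps_const (e/32) * (fps_X * (J * J)) + fps_const (1/2) * (T u2 u2 + fps_const (e/16) * (fps_X * J))
        + fps_const (-1/16) * T u1 u2 + fps_const (-1/32) * (T u u2 - fps_const e))"
    proof -
      have "fps_const (e/32) * (fps_X * (J * J)) = fps_X * (fps_const (e/32) * (fps_X * (J * J))
         + fps_const (e/32) * (fps_X * J) + fps_const (e/32))"
        by (subst J2, subst (3) J1) (simp add: algebra_simps)
      moreover have B: "fps_const (1/2) * (T u2 u2 + fps_const (e/16) * (fps_X * J)) = 
         fps_const (1/2) * T u2 u2 + fps_const (e/32) * (fps_X * J)"
        by (simp add: distrib_left mult.assoc[symmetric])
      moreover have C: "fps_const (-1/32) * (T u u2 - fps_const e) = fps_const (-1/32) * T u u2 + fps_const (e/32)"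
        by (simp add: right_diff_distrib)
      ultimately show ?thesis
        using T_u3[of u2] unfolding B C T_comm[of u2 u] T_comm[of u2 u1] by algebra
    qed
    \<comment> \<open>The constant term of \<open>T u u\<close> is
      \<open>(16 - \<kappa>) * e + \<kappa> * e\<close>, so \<open>\<kappa>\<close> drops
      out.\<close>
    show "(T u u - fps_const (16 * e)) $ 0 = 0"
      using init0 init2 by (simp add: T_def jet_form_def power2_eq_square algebra_simps)
    show "T u u1 $ 0 = 0" "(T u1 u1 + fps_const e) $ 0 = 0" "T u1 u2 $ 0 = 0"
         "(T u u2 - fps_const e) $ 0 = 0"
         "(T u2 u2 + fps_const (e/16) * (fps_X * J)) $ 0 = 0"
      using init0 by (simp_all add: T_def jet_form_def init power2_eq_square)
  qed
  show "jet_form \<kappa> u u = fps_const (16 * e)"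
    using T by (simp add: T_def)
  show "jet_form \<kappa> u (theta u) = 0"
    using T by (simp add: T_def u1_def)
qed

subsection \<open>The hypergeometric coefficients\<close>

lemma has_fps_expansion_scale_arg:
  assumes "f has_fps_expansion (F :: complex fps)"
  shows "(\<lambda>x. f (c * x)) has_fps_expansion Abs_fps (\<lambda>n. c ^ n * fps_nth F n)"
proof -
  have "(f \<circ> (\<lambda>x. c * x)) has_fps_expansion fps_compose F (fps_const c * fps_X)"
    by (intro has_fps_expansion_compose assms has_fps_expansion_cmult_left has_fps_expansion_fps_X) simp
  thus ?thesis
    by (simp add: o_def fps_compose_linear)
qed

lemma not_nonpos_Ints_of_Re_pos: "Re z > 0 \<Longrightarrow> z \<notin> \<int>\<^sub>\<le>\<^sub>0"
  by (auto elim!: nonpos_Ints_cases)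

lemma Re_bounds: "norm (t :: complex) \<le> r \<Longrightarrow> - r \<le> Re t \<and> Re t \<le> r"
  using abs_Re_le_cmod[of t] by linarith

text \<open>
  This is \<open>y\<^sup>-\<^sup>N\<close> times the \<open>N\<close>-th antidiagonal sum for \<open>a = 1/2\<close>, with the four lower Gamma factors,
  whose arguments are \<open>N+1\<close>, \<open>N+s+1\<close>, \<open>N+t+1\<close> and \<open>N+s+t+1\<close>, all replaced by the one at their mean \<open>N+\<tau>+1\<close>.
\<close>

definition qcoeff :: "complex \<Rightarrow> nat \<Rightarrow> complex \<Rightarrow> complex" where
  "qcoeff L N \<tau> = exp ((1/2 - 2 * \<tau>) * L) / 16 ^ N * rGamma (3/2 - 2 * \<tau> - 2 * of_nat N) *
     Gamma (2 * of_nat N + 2 * \<tau> + 1) * rGamma (of_nat N + \<tau> + 1) ^ 4"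

text \<open>With \<open>h = N + \<tau>\<close>, the functional equation of Gamma gives the ratio
  \<open>16 (h^2 - 1/16)(h + 1/2)(h + 1) / (16 (h + 1)^4)\<close>; one factor \<open>h + 1\<close>
  cancels and leaves a cube. The bound on \<open>\<tau>\<close> keeps the arguments of Gamma off the
  poles.\<close>

lemma qcoeff_Suc:
  assumes "norm \<tau> \<le> 1/8"
  shows "(of_nat (Suc N) + \<tau>) ^ 3 * qcoeff L (Suc N) \<tau> =
     ((of_nat N + \<tau>) ^ 2 - 1/16) * (of_nat N + \<tau> + 1/2) * qcoeff L N \<tau>"
proof -
  define h where "h = of_nat N + \<tau>"
  have Reh: "Re h > -1/2" using Re_bounds[OF assms] by (auto simp: h_def)
  have 1: "rGamma (3/2 - 2 * \<tau> - 2 * of_nat (Suc N)) = (-1/2 - 2 * h) * (1/2 - 2 * h) * rGamma (3/2 - 2 * \<tau> - 2 * of_nat N)"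
  proof -
    have "3/2 - 2 * \<tau> - 2 * of_nat (Suc N) = -1/2 - 2 * h" "3/2 - 2 * \<tau> - 2 * of_nat N = (1/2 - 2 * h) + 1"
      "(-1/2 - 2 * h) + 1 = 1/2 - 2 * h"
      by (simp_all add: h_def field_simps)
    thus ?thesis
      using rGamma_plus1[of "-1/2 - 2 * h"] rGamma_plus1[of "1/2 - 2 * h"] by (metis mult.assoc)
  qed
  have 2: "Gamma (2 * of_nat (Suc N) + 2 * \<tau> + 1) = (2 * h + 2) * (2 * h + 1) * Gamma (2 * of_nat N + 2 * \<tau> + 1)"
  proof -
    have "Gamma (2 * h + 1 + 1) = (2 * h + 1) * Gamma (2 * h + 1)"
      by (rule Gamma_plus1, rule not_nonpos_Ints_of_Re_pos) (use Reh in simp)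
    moreover have "Gamma (2 * h + 2 + 1) = (2 * h + 2) * Gamma (2 * h + 2)"
      by (rule Gamma_plus1, rule not_nonpos_Ints_of_Re_pos) (use Reh in simp)
    ultimately show ?thesis by (simp add: h_def algebra_simps)
  qed
  define R where "R = rGamma (of_nat (Suc N) + \<tau> + 1)"
  have 3: "rGamma (of_nat N + \<tau> + 1) = (h + 1) * R"
    using rGamma_plus1[of "h + 1"] by (simp add: h_def R_def algebra_simps)
  define K where "K = exp ((1/2 - 2 * \<tau>) * L) / 16 ^ N * rGamma (3/2 - 2 * \<tau> - 2 * of_nat N) *
    Gamma (2 * of_nat N + 2 * \<tau> + 1)"
  have S: "16 * qcoeff L (Suc N) \<tau> = K * ((-1/2 - 2 * h) * (1/2 - 2 * h)) * ((2 * h + 2) * (2 * h + 1)) * R ^ 4"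
    unfolding qcoeff_def 1 2 K_def R_def[symmetric] by simp
  have Z: "qcoeff L N \<tau> = K * ((h + 1) * R) ^ 4"
    unfolding qcoeff_def 3 K_def ..
  have "(-1/2 - 2 * h) * (1/2 - 2 * h) * ((2 * h + 2) * (2 * h + 1)) = 16 * ((h\<^sup>2 - 1/16) * (h + 1/2)) * (h + 1)"
    by (simp add: field_simps power2_eq_square)
  hence "16 * ((h + 1) ^ 3 * qcoeff L (Suc N) \<tau>) = 16 * ((h\<^sup>2 - 1/16) * (h + 1/2) * qcoeff L N \<tau>)"
    using S Z by algebra
  thus ?thesis
    by (simp add: h_def add_ac)
qed

text \<open>The ratio in the recursion has modulus at most one, because
  \<open>|h^2 - 1/16| \<le> |h + 1|^2\<close> and \<open>|h + 1/2| \<le> |h + 1|\<close>. This makes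
  every later estimate uniform in \<open>N\<close>.\<close>

lemma norm_qcoeff_le:
  assumes "norm \<tau> \<le> 1/8"
  shows "norm (qcoeff L N \<tau>) \<le> norm (qcoeff L 0 \<tau>)"
proof (induction N)
  case (Suc N)
  define h where "h = of_nat N + \<tau>"
  have n1: "norm h \<le> of_nat N + 1/8"
    using norm_triangle_ineq[of "of_nat N" \<tau>] assms by (simp add: h_def)
  have n2: "norm (h + 1) \<ge> of_nat N + 7/8"
  proof -
    have "of_nat (Suc N) = norm (of_nat (Suc N) :: complex)" by (simp only: norm_of_nat)
    also have "of_nat (Suc N) = (h + 1) - \<tau>" by (simp add: h_def)
    also have "norm \<dots> \<le> norm (h + 1) + norm \<tau>" by (rule norm_triangle_ineq4)
    finally show ?thesis using assms by simp
  qed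
  have "norm (h\<^sup>2 - 1/16) \<le> norm h ^ 2 + 1/16"
    using norm_triangle_ineq4[of "h\<^sup>2" "1/16"] by (simp add: norm_power)
  also have "\<dots> \<le> (of_nat N + 1/8) ^ 2 + 1/16"
    using n1 by (intro add_mono power_mono) auto
  also have "\<dots> \<le> (of_nat N + 7/8) ^ 2"
    by (simp add: power2_eq_square algebra_simps)
  also have "\<dots> \<le> norm (h + 1) ^ 2"
    using n2 by (intro power_mono) auto
  finally have a: "norm (h\<^sup>2 - 1/16) \<le> norm (h + 1) ^ 2" .
  have b: "norm (h + 1/2) \<le> norm (h + 1)"
    using norm_triangle_ineq[of h "1/2"] n1 n2 by simp
  have c: "norm (h + 1) > 0" using n2 by linarith
  have "norm (h + 1) ^ 3 * norm (qcoeff L (Suc N) \<tau>) = norm (h\<^sup>2 - 1/16) * norm (h + 1/2) * norm (qcoeff L N \<tau>)"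
    using arg_cong[OF qcoeff_Suc[OF assms, of N L], of norm]
    by (simp add: norm_mult norm_power h_def add_ac)
  also have "\<dots> \<le> norm (h + 1) ^ 2 * norm (h + 1) * norm (qcoeff L 0 \<tau>)"
    using a b Suc by (intro mult_mono) auto
  also have "\<dots> = norm (h + 1) ^ 3 * norm (qcoeff L 0 \<tau>)"
    by (simp add: power3_eq_cube power2_eq_square)
  finally show ?case using c by simp
qed auto

section \<open>Taylor jets of the coefficients at \<open>\<tau> = 0\<close> and their values at
  \<open>y = 0\<close>\<close>

lemma Gamma_2N_nonpole: "norm (\<tau> :: complex) \<le> 1/8 \<Longrightarrow> 2 * of_nat N + 2 * \<tau> + 1 \<notin> \<int>\<^sub>\<le>\<^sub>0"
  by (intro not_nonpos_Ints_of_Re_pos) (use Re_bounds[of \<tau> "1/8"] in auto)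

lemma holomorphic_qcoeff: "qcoeff L N holomorphic_on cball 0 (1/8)"
  unfolding qcoeff_def using Gamma_2N_nonpole
  by (auto intro!: holomorphic_intros)

definition qjet :: "complex \<Rightarrow> nat \<Rightarrow> complex fps" where
  "qjet L N = fps_expansion (qcoeff L N) 0"

lemma qcoeff_has_fps_expansion: "qcoeff L N has_fps_expansion qjet L N"
  unfolding qjet_def
  by (rule has_fps_expansion_fps_expansion[of "ball 0 (1/8)"])
     (auto intro: holomorphic_on_subset[OF holomorphic_qcoeff])

lemma eventually_nhds_0_norm_le: "(0::real) < r \<Longrightarrow> eventually (\<lambda>t :: complex. norm t \<le> r) (nhds 0)"
  using eventually_nhds_in_open[of "ball 0 r" 0] by (auto elim!: eventually_mono)

lemma has_fps_expansion_unique: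
  assumes "f has_fps_expansion F" "g has_fps_expansion G" "eventually (\<lambda>x. f x = g x) (nhds 0)"
  shows "F = (G :: complex fps)"
  using assms has_fps_expansion_cong[OF assms(3) refl] by (metis fps_expansion_eqI)

lemma qjet_Suc:
  "(of_nat (Suc N) + fps_X) ^ 3 * qjet L (Suc N) =
     ((of_nat N + fps_X) ^ 2 - fps_const (1/16)) * (of_nat N + fps_X + fps_const (1/2)) * qjet L N"
proof (rule has_fps_expansion_unique)
  show "(\<lambda>\<tau>. (of_nat (Suc N) + \<tau>) ^ 3 * qcoeff L (Suc N) \<tau>) has_fps_expansion
    (of_nat (Suc N) + fps_X) ^ 3 * qjet L (Suc N)"
    unfolding fps_of_nat[symmetric] by (intro fps_expansion_intros qcoeff_has_fps_expansion)
  show "(\<lambda>\<tau>. ((of_nat N + \<tau>) ^ 2 - 1/16) * (of_nat N + \<tau> + 1/2) * qcoeff L N \<tau>) has_fps_expansion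
    ((of_nat N + fps_X) ^ 2 - fps_const (1/16)) * (of_nat N + fps_X + fps_const (1/2)) * qjet L N"
    unfolding fps_of_nat[symmetric] by (intro fps_expansion_intros qcoeff_has_fps_expansion)
  show "\<forall>\<^sub>F x in nhds 0. (of_nat (Suc N) + x) ^ 3 * qcoeff L (Suc N) x =
           ((of_nat N + x)\<^sup>2 - 1 / 16) * (of_nat N + x + 1 / 2) * qcoeff L N x"
    by (rule eventually_mono[OF eventually_nhds_0_norm_le[of "1/8"]]) (simp, rule qcoeff_Suc)
qed

text \<open>Reflection pairs the Gamma factors at \<open>\<tau>\<close> and \<open>-\<tau>\<close>
  into sines and cosines; \<open>1 - 16 \<tau>^2\<close> comes from lowering the argument
  \<open>3/2\<close> to \<open>1/2\<close> on both sides. The identity is kept free of division so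
  that it also holds at \<open>\<tau> = 0\<close> and carries over to power series.\<close>

lemma qcoeff_0_reflection:
  assumes "norm \<tau> \<le> 1/8"
  shows "(1 - 16 * \<tau>\<^sup>2) * (qcoeff L 0 \<tau> * qcoeff L 0 (- \<tau>)) * cos (of_real pi * \<tau>) * (of_real pi * \<tau>) ^ 3 =
     4 * exp L / of_real pi * cos (2 * of_real pi * \<tau>) * sin (of_real pi * \<tau>) ^ 3"
proof (cases "\<tau> = 0")
  case False
  define S where "S = sin (of_real pi * \<tau>)"
  define C where "C = cos (of_real pi * \<tau>)"
  define s where "s = rGamma (1 + \<tau>) * rGamma (1 - \<tau>)"
  define g where "g = Gamma (1 + 2 * \<tau>) * Gamma (1 - 2 * \<tau>)"
  define c where "c = cos (2 * of_real pi * \<tau>)"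
  define p where "p = complex_of_real pi"
  have p: "p \<noteq> 0" by (simp add: p_def)
  have ref: "rGamma (1 + x) * rGamma (1 - x) * (x * p) = sin (p * x)" for x :: complex
  proof -
    have "rGamma x * rGamma (1 - x) * p = sin (p * x)"
      using rGamma_reflection_complex[of x] p by (simp add: p_def)
    moreover have "x * rGamma (1 + x) = rGamma x"
      using rGamma_plus1[of x] by (simp add: add_ac)
    ultimately have "x * rGamma (1 + x) * rGamma (1 - x) * p = sin (p * x)"
      by (simp only:)
    thus ?thesis by (simp only: mult_ac)
  qed
  have s: "s * (\<tau> * p) = S"
    using ref[of \<tau>] by (simp add: s_def S_def p_def)
  have g: "g * (S * C) = \<tau> * p"
  proof -
    have "1 + 2 * \<tau> \<notin> \<int>\<^sub>\<le>\<^sub>0" "1 - 2 * \<tau> \<notin> \<int>\<^sub>\<le>\<^sub>0"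
      by (intro not_nonpos_Ints_of_Re_pos; use Re_bounds[OF assms] in auto)+
    hence "g * (rGamma (1 + 2 * \<tau>) * rGamma (1 - 2 * \<tau>)) = 1"
      by (simp add: g_def Gamma_def rGamma_eq_zero_iff field_simps)
    moreover have "rGamma (1 + 2 * \<tau>) * rGamma (1 - 2 * \<tau>) * (2 * \<tau> * p) = 2 * S * C"
      using ref[of "2 * \<tau>"] sin_double[of "p * \<tau>"] by (simp add: S_def C_def p_def mult_ac)
    ultimately show ?thesis by algebra
  qed
  have h: "rGamma (1/2 - 2 * \<tau>) * rGamma (1/2 + 2 * \<tau>) * p = c"
  proof -
    have "rGamma (1/2 - 2 * \<tau>) * rGamma (1/2 + 2 * \<tau>) = sin (p * (1/2 - 2 * \<tau>)) / p"
      using rGamma_reflection_complex[of "1/2 - 2 * \<tau>"] by (simp add: p_def algebra_simps)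
    also have "p * (1/2 - 2 * \<tau>) = of_real pi / 2 - 2 * of_real pi * \<tau>"
      by (simp add: p_def algebra_simps)
    also have "sin \<dots> = c"
      by (simp add: c_def sin_diff)
    finally show ?thesis using p by simp
  qed
  have e: "exp ((1/2 - 2 * \<tau>) * L) * exp ((1/2 + 2 * \<tau>) * L) = exp L"
    by (simp add: exp_add[symmetric] algebra_simps)
  have r: "rGamma (1/2 - 2 * x) = (1/2 - 2 * x) * rGamma (3/2 - 2 * x)" for x :: complex
    using rGamma_plus1[of "1/2 - 2 * x"] by (simp add: algebra_simps)
  have q1: "qcoeff L 0 \<tau> * (1/2 - 2 * \<tau>) = exp ((1/2 - 2 * \<tau>) * L) * rGamma (1/2 - 2 * \<tau>) * Gamma (1 + 2 * \<tau>) * rGamma (1 + \<tau>) ^ 4"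
    unfolding r qcoeff_def by (simp add: add_ac mult_ac)
  have q2: "qcoeff L 0 (-\<tau>) * (1/2 + 2 * \<tau>) = exp ((1/2 + 2 * \<tau>) * L) * rGamma (1/2 + 2 * \<tau>) * Gamma (1 - 2 * \<tau>) * rGamma (1 - \<tau>) ^ 4"
    unfolding r[of "- \<tau>", simplified] qcoeff_def by (simp add: add_ac mult_ac)
  have "(1 - 16 * \<tau>\<^sup>2) * (qcoeff L 0 \<tau> * qcoeff L 0 (- \<tau>)) * p =
     4 * (qcoeff L 0 \<tau> * (1/2 - 2 * \<tau>)) * (qcoeff L 0 (-\<tau>) * (1/2 + 2 * \<tau>)) * p"
    by (simp add: power2_eq_square algebra_simps)
  also have "\<dots> = 4 * (exp ((1/2 - 2 * \<tau>) * L) * exp ((1/2 + 2 * \<tau>) * L)) *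
     (rGamma (1/2 - 2 * \<tau>) * rGamma (1/2 + 2 * \<tau>) * p) * g * s ^ 4"
    unfolding q1 q2 s_def g_def by (simp add: power4_eq_xxxx mult_ac)
  finally have q: "(1 - 16 * \<tau>\<^sup>2) * (qcoeff L 0 \<tau> * qcoeff L 0 (- \<tau>)) * p = 4 * exp L * c * g * s ^ 4"
    unfolding e h .
  \<comment> \<open>The duplication \<open>sin 2x = 2 sin x cos x\<close> lets \<open>g\<close>
    cancel one of the four factors \<open>s\<close>, so only a cube of the sine survives.\<close>
  have gs: "g * s * C = 1"
  proof -
    have "(g * s * C) * (\<tau> * p) = 1 * (\<tau> * p)"
      using g s by algebra
    thus ?thesis using False p by simp
  qed
  have "(1 - 16 * \<tau>\<^sup>2) * (qcoeff L 0 \<tau> * qcoeff L 0 (- \<tau>)) * C * (p * \<tau>) ^ 3 * p =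
     4 * exp L * c * (g * s * C) * (s * (\<tau> * p)) ^ 3"
    using q by algebra
  hence "(1 - 16 * \<tau>\<^sup>2) * (qcoeff L 0 \<tau> * qcoeff L 0 (- \<tau>)) * C * (p * \<tau>) ^ 3 * p = 4 * exp L * c * S ^ 3"
    unfolding gs s by simp
  thus ?thesis
    using p by (simp add: field_simps C_def S_def c_def p_def)
qed auto


lemma fps_mult_nth_2: "fps_nth (f * g) 2 = fps_nth f 0 * fps_nth g 2 + fps_nth f 1 * fps_nth g 1 + fps_nth f 2 * fps_nth g 0"
  by (simp add: fps_mult_nth numeral_2_eq_2)

text \<open>Both left-hand sides are coefficients of the even function
  \<open>qcoeff L 0 \<tau> * qcoeff L 0 (-\<tau>)\<close>, in degrees 0 and 2. In degree 2,
  \<open>1 - 16 \<tau>^2\<close> contributes 16 and \<open>cos (2\<pi>\<tau>)\<close> contributes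
  \<open>-2\<pi>^2\<close>, while the contributions of \<open>cos (\<pi>\<tau>)\<close> and of the
  sine cubed cancel. Hence \<open>\<kappa> = 2\<pi>^2\<close> in the form.\<close>

lemma qjet_0_form:
  "(fps_nth (qjet L 0) 0)\<^sup>2 = 4 * exp L / of_real pi" (is ?A)
  "2 * fps_nth (qjet L 0) 0 * fps_nth (qjet L 0) 2 - (fps_nth (qjet L 0) 1)\<^sup>2 =
     (16 - 2 * of_real pi ^ 2) * (4 * exp L / of_real pi)" (is ?B)
proof -
  define p where "p = complex_of_real pi"
  define e where "e = 4 * exp L / p"
  define W where "W = qjet L 0"
  define F where "F = W * Abs_fps (\<lambda>n. (-1) ^ n * fps_nth W n)"
  define S where "S = Abs_fps (\<lambda>n. fps_nth (fps_sin p) (Suc n))"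
  have p: "p \<noteq> 0" by (simp add: p_def)
  have S: "fps_sin p = S * fps_X"
    by (rule fps_ext) (simp add: S_def fps_sin_def)
  have "(1 - fps_const 16 * fps_X ^ 2) * F * fps_cos p * (fps_const p * fps_X) ^ 3 =
        fps_const e * fps_cos (2 * p) * fps_sin p ^ 3"
  proof (rule has_fps_expansion_unique)
    have "(\<lambda>\<tau>. qcoeff L 0 (- \<tau>)) has_fps_expansion Abs_fps (\<lambda>n. (-1) ^ n * fps_nth W n)"
      using has_fps_expansion_scale_arg[OF qcoeff_has_fps_expansion, of L 0 "-1"] by (simp add: W_def)
    thus "(\<lambda>\<tau>. (1 - 16 * \<tau>\<^sup>2) * (qcoeff L 0 \<tau> * qcoeff L 0 (- \<tau>)) * cos (p * \<tau>) * (p * \<tau>) ^ 3)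
      has_fps_expansion (1 - fps_const 16 * fps_X ^ 2) * F * fps_cos p * (fps_const p * fps_X) ^ 3"
      unfolding F_def W_def by (intro fps_expansion_intros qcoeff_has_fps_expansion)
    show "(\<lambda>\<tau>. e * cos (2 * p * \<tau>) * sin (p * \<tau>) ^ 3) has_fps_expansion fps_const e * fps_cos (2 * p) * fps_sin p ^ 3"
      by (intro fps_expansion_intros)
    show "\<forall>\<^sub>F x in nhds 0. (1 - 16 * x\<^sup>2) * (qcoeff L 0 x * qcoeff L 0 (- x)) * cos (p * x) * (p * x) ^ 3 =
       e * cos (2 * p * x) * sin (p * x) ^ 3"
      by (rule eventually_mono[OF eventually_nhds_0_norm_le[of "1/8"]])
         (simp, unfold p_def e_def, rule qcoeff_0_reflection)
  qed
  \<comment> \<open>Both sides contain \<open>fps_X ^ 3\<close>, since \<open>S\<close> is the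
    series of \<open>sin (p\<tau>)/\<tau>\<close>; it is cancelled before coefficients are
    compared.\<close>
  hence "((1 - fps_const 16 * fps_X ^ 2) * F * fps_cos p * fps_const (p ^ 3)) * fps_X ^ 3 =
         (fps_const e * fps_cos (2 * p) * (S * S * S)) * fps_X ^ 3"
    by (simp add: S power_mult_distrib mult_ac power3_eq_cube)
  hence *: "(1 - fps_const 16 * fps_X ^ 2) * F * fps_cos p * fps_const (p ^ 3) =
            fps_const e * fps_cos (2 * p) * (S * S * S)"
    by (subst (asm) mult_right_cancel) auto
  have S_nth: "fps_nth S 0 = p" "fps_nth S 1 = 0" "fps_nth S 2 = - (p ^ 3 / 6)"
  proof -
    have "fps_nth S 2 = fps_nth (fps_sin p) 3" by (simp add: S_def numeral_3_eq_3 numeral_2_eq_2)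
    thus "fps_nth S 2 = - (p ^ 3 / 6)" by (simp add: fps_sin_def fact_numeral)
  qed (simp_all add: S_def fps_sin_def)
  have cos_nth: "fps_nth (fps_cos c) 0 = 1" "fps_nth (fps_cos c) 1 = 0" "fps_nth (fps_cos c) 2 = - (c\<^sup>2 / 2)" for c :: complex
    by (simp_all add: fps_cos_def fact_numeral)
  have one_nth: "fps_nth (1 - fps_const (16::complex) * fps_X ^ 2) 0 = 1" "fps_nth (1 - fps_const (16::complex) * fps_X ^ 2) 1 = 0"
     "fps_nth (1 - fps_const (16::complex) * fps_X ^ 2) 2 = -16"
    by simp_all
  have "fps_nth F 0 * p ^ 3 = e * p ^ 3"
    using arg_cong[OF *, of "\<lambda>f. fps_nth f 0"] by (simp add: S_nth cos_nth power3_eq_cube)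
  hence F0: "fps_nth F 0 = e" using p by simp
  have "(fps_nth F 2 - 16 * e - e * p\<^sup>2 / 2) * p ^ 3 = - (2 * e) * p\<^sup>2 * p ^ 3 - e * p ^ 3 * p\<^sup>2 / 2"
    using arg_cong[OF *, of "\<lambda>f. fps_nth f 2"]
    by (simp add: fps_mult_nth_2 fps_mult_nth_1 S_nth S_nth(2)[simplified] cos_nth cos_nth(2)[simplified] one_nth one_nth(2)[simplified] F0) (simp add: field_simps power_numeral_reduce)
  hence "(fps_nth F 2 - (16 - 2 * p\<^sup>2) * e) * p ^ 3 = 0"
    by algebra
  hence F2: "fps_nth F 2 = (16 - 2 * p\<^sup>2) * e" using p by simp
  show ?A
    using F0 by (simp add: F_def W_def e_def p_def power2_eq_square)
  show ?B
    using F2 by (simp add: F_def W_def e_def p_def power2_eq_square fps_mult_nth_2 mult.assoc)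
qed

text \<open>Cauchy's inequality on the circle of radius 1/8, with the bound of
  \<open>qcoeff L 0\<close> serving all \<open>N\<close>. For fixed \<open>k\<close> the
  coefficients are thus bounded in \<open>N\<close>, which yields convergence for
  \<open>|y| < 1\<close>.\<close>

lemma qjet_bound:
  obtains K where "\<And>N k. norm (fps_nth (qjet L N) k) \<le> K * 8 ^ k"
proof -
  have "compact (cball 0 (1/8) :: complex set)" by simp
  then obtain K where K: "\<And>\<tau>. \<tau> \<in> cball 0 (1/8) \<Longrightarrow> norm (qcoeff L 0 \<tau>) \<le> K"
    using compact_continuous_image[OF holomorphic_on_imp_continuous_on[OF holomorphic_qcoeff]]
    by (meson compact_imp_bounded bounded_iff imageI)
  have "norm (fps_nth (qjet L N) k) \<le> K * 8 ^ k" for N k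
  proof -
    have "norm ((deriv ^^ k) (qcoeff L N) 0) \<le> fact k * K / (1/8) ^ k"
    proof (rule Cauchy_inequality)
      show "continuous_on (cball 0 (1/8)) (qcoeff L N)"
        by (intro holomorphic_on_imp_continuous_on holomorphic_qcoeff)
      show "qcoeff L N holomorphic_on ball 0 (1/8)"
        by (rule holomorphic_on_subset[OF holomorphic_qcoeff]) auto
      show "norm (qcoeff L N x) \<le> K" if "norm (0 - x) = 1/8" for x
        using that norm_qcoeff_le[of x L N] K[of x] by simp
    qed auto
    thus ?thesis
      by (simp add: fps_nth_fps_expansion[OF qcoeff_has_fps_expansion] norm_divide field_simps power_divide)
  qed
  thus ?thesis by (rule that)
qed

section \<open>Convergence in \<open>y\<close> and evaluation of the quadratic form\<close>

lemma fps_conv_radius_ge_1: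
  assumes "\<And>n. norm (fps_nth f n) \<le> K"
  shows "fps_conv_radius (f :: complex fps) \<ge> 1"
  unfolding fps_conv_radius_def
proof (rule conv_radius_geI_ex')
  fix r :: real assume r: "0 < r" "ereal r < 1"
  show "summable (\<lambda>n. fps_nth f n * of_real r ^ n)"
  proof (rule summable_comparison_test', rule summable_mult)
    show "summable (\<lambda>n. r ^ n)" using r by (simp add: summable_geometric)
    show "norm (fps_nth f n * of_real r ^ n) \<le> K * r ^ n" for n
      using assms[of n] r by (simp add: norm_mult norm_power mult_right_mono)
  qed
qed

lemma fps_conv_radius_col_qjet: "fps_conv_radius (col k (qjet L)) \<ge> 1"
proof -
  obtain K where "\<And>N k. norm (fps_nth (qjet L N) k) \<le> K * 8 ^ k"
    using qjet_bound[of L] by metis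
  thus ?thesis
    by (intro fps_conv_radius_ge_1[of _ "K * 8 ^ k"]) simp
qed

lemma fps_conv_radius_XD: "fps_conv_radius (fps_XD (f :: complex fps)) \<ge> fps_conv_radius f"
proof -
  have "fps_conv_radius f \<le> min (fps_conv_radius (fps_X :: complex fps)) (fps_conv_radius (fps_deriv f))"
    using fps_conv_radius_deriv[of f] by simp
  also have "\<dots> \<le> fps_conv_radius (fps_XD f)"
    unfolding fps_XD_def o_def by (rule fps_conv_radius_mult)
  finally show ?thesis .
qed

lemma fps_conv_radius_col_theta_qjet: "fps_conv_radius (col k (theta (qjet L))) \<ge> 1"
proof (cases k)
  case 0
  thus ?thesis
    using order_trans[OF fps_conv_radius_col_qjet[of 0 L] fps_conv_radius_XD] by (simp add: col_0_theta)
next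
  case (Suc l)
  have "1 \<le> min (fps_conv_radius (fps_XD (col (Suc l) (qjet L)))) (fps_conv_radius (col l (qjet L)))"
    using order_trans[OF fps_conv_radius_col_qjet[of "Suc l" L] fps_conv_radius_XD]
      fps_conv_radius_col_qjet[of l L] by (rule min.boundedI)
  also have "\<dots> \<le> fps_conv_radius (col k (theta (qjet L)))"
    unfolding Suc col_Suc_theta by (rule fps_conv_radius_add)
  finally show ?thesis .
qed

lemma eval_jet_form:
  assumes v: "\<And>k. fps_conv_radius (col k v) \<ge> 1" and w: "\<And>k. fps_conv_radius (col k w) \<ge> 1"
    and y: "norm y < 1"
  shows "eval_fps (jet_form \<kappa> v w) y =
    eval_fps (col 0 v) y * eval_fps (col 2 w) y - eval_fps (col 1 v) y * eval_fps (col 1 w) y +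
    eval_fps (col 2 v) y * eval_fps (col 0 w) y + \<kappa> * (eval_fps (col 0 v) y * eval_fps (col 0 w) y)"
proof -
  have y: "ereal (norm y) < 1" using y by simp
  have vw: "norm y < fps_conv_radius (col k v)" "norm y < fps_conv_radius (col k w)" for k
    by (rule less_le_trans[OF y v], rule less_le_trans[OF y w])
  have mult: "norm y < fps_conv_radius (f * g)" if "norm y < fps_conv_radius f" "norm y < fps_conv_radius g"
    for f g :: "complex fps"
    by (rule less_le_trans[OF _ fps_conv_radius_mult]) (use that in simp)
  have add: "norm y < fps_conv_radius (f + g)" if "norm y < fps_conv_radius f" "norm y < fps_conv_radius g"
    for f g :: "complex fps"
    by (rule less_le_trans[OF _ fps_conv_radius_add]) (use that in simp)
  have diff: "norm y < fps_conv_radius (f - g)" if "norm y < fps_conv_radius f" "norm y < fps_conv_radius g"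
    for f g :: "complex fps"
    by (rule less_le_trans[OF _ fps_conv_radius_diff]) (use that in simp)
  show ?thesis
    unfolding jet_form_def by (simp add: eval_fps_add eval_fps_diff eval_fps_mult vw mult add diff)
qed

lemma qjet_sums:
  assumes "norm y < 1"
  shows "(\<lambda>N. fps_nth (qjet L N) k * y ^ N) sums eval_fps (col k (qjet L)) y"
    and "(\<lambda>N. fps_nth (theta (qjet L) N) k * y ^ N) sums eval_fps (col k (theta (qjet L))) y"
proof -
  have "ereal (norm y) < 1" using assms by simp
  hence "norm y < fps_conv_radius (col k (qjet L))" "norm y < fps_conv_radius (col k (theta (qjet L)))"
    by (rule less_le_trans[OF _ fps_conv_radius_col_qjet], rule less_le_trans[OF _ fps_conv_radius_col_theta_qjet])
  thus "(\<lambda>N. fps_nth (qjet L N) k * y ^ N) sums eval_fps (col k (qjet L)) y"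
    "(\<lambda>N. fps_nth (theta (qjet L) N) k * y ^ N) sums eval_fps (col k (theta (qjet L))) y"
    using sums_eval_fps[of y "col k (qjet L)"] sums_eval_fps[of y "col k (theta (qjet L))"] by simp_all
qed

text \<open>\<open>V\<close> is the series of \<open>(1/2 - 2\<theta>) u\<close>, that is, of
  \<open>z d/dz\<close> applied to the solution. By bilinearity the left-hand side is half the form
  of \<open>u\<close> with itself minus twice the form of \<open>u\<close> with
  \<open>theta u\<close>, hence \<open>8e - 0\<close> with
  \<open>e = 4 exp L / \<pi>\<close>.\<close>

lemma qjet_pairing:
  assumes y: "norm y < 1"
    and U: "\<And>k. k \<le> 2 \<Longrightarrow> (\<lambda>N. fps_nth (qjet L N) k * y ^ N) sums U k"
    and V: "\<And>k. k \<le> 2 \<Longrightarrow> (\<lambda>N. fps_nth ((fps_const (1/2) - 2 * (of_nat N + fps_X)) * qjet L N) k * y ^ N) sums V k"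
  shows "U 0 * V 2 - U 1 * V 1 + U 2 * V 0 + 2 * of_real pi ^ 2 * (U 0 * V 0) = 32 * exp L / of_real pi"
proof -
  define \<kappa> where "\<kappa> = 2 * complex_of_real pi ^ 2"
  define e where "e = 4 * exp L / complex_of_real pi"
  define u where "u = (\<lambda>k. eval_fps (col k (qjet L)) y)"
  define t where "t = (\<lambda>k. eval_fps (col k (theta (qjet L))) y)"
  have form: "jet_form \<kappa> (qjet L) (qjet L) = fps_const (16 * e)" "jet_form \<kappa> (qjet L) (theta (qjet L)) = 0"
    using jet_form_eq_const[where u = "qjet L" and e = e and \<kappa> = \<kappa>] qjet_Suc[of _ L] qjet_0_form[of L] by (simp_all add: e_def \<kappa>_def)
  have A: "u 0 * u 2 - u 1 * u 1 + u 2 * u 0 + \<kappa> * (u 0 * u 0) = 16 * e"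
    using eval_jet_form[of "qjet L" "qjet L" y \<kappa>] y fps_conv_radius_col_qjet by (simp add: form u_def)
  have B: "u 0 * t 2 - u 1 * t 1 + u 2 * t 0 + \<kappa> * (u 0 * t 0) = 0"
    using eval_jet_form[of "qjet L" "theta (qjet L)" y \<kappa>] y fps_conv_radius_col_qjet fps_conv_radius_col_theta_qjet
    by (simp add: form u_def t_def)
  have U: "U k = u k" if "k \<le> 2" for k
    using U[OF that] qjet_sums(1)[OF y] unfolding u_def by (rule sums_unique2)
  have V: "V k = u k / 2 - 2 * t k" if "k \<le> 2" for k
  proof -
    have "(\<lambda>N. fps_nth (qjet L N) k * y ^ N / 2 - 2 * (fps_nth (theta (qjet L) N) k * y ^ N)) sums (u k / 2 - 2 * t k)"
      unfolding u_def t_def by (intro sums_diff sums_divide sums_mult qjet_sums y)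
    also have "(\<lambda>N. fps_nth (qjet L N) k * y ^ N / 2 - 2 * (fps_nth (theta (qjet L) N) k * y ^ N)) =
       (\<lambda>N. fps_nth ((fps_const (1/2) - 2 * (of_nat N + fps_X)) * qjet L N) k * y ^ N)"
      by (simp add: theta_def left_diff_distrib mult.assoc fps_numeral_fps_const)
    finally show ?thesis by (rule sums_unique2[OF V[OF that]])
  qed
  have le: "(0::nat) \<le> 2" "(1::nat) \<le> 2" "(2::nat) \<le> 2" by simp_all
  have "U 0 * V 2 - U 1 * V 1 + U 2 * V 0 + \<kappa> * (U 0 * V 0) =
      (u 0 * u 2 - u 1 * u 1 + u 2 * u 0 + \<kappa> * (u 0 * u 0)) / 2
      - 2 * (u 0 * t 2 - u 1 * t 1 + u 2 * t 0 + \<kappa> * (u 0 * t 0))"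
    unfolding U[OF le(1)] U[OF le(2)] U[OF le(3)] V[OF le(1)] V[OF le(2)] V[OF le(3)]
    by (simp add: field_simps)
  hence "U 0 * V 2 - U 1 * V 1 + U 2 * V 0 + \<kappa> * (U 0 * V 0) = 8 * e"
    unfolding A B by simp
  thus ?thesis by (simp add: \<kappa>_def e_def)
qed

subsection \<open>Convergence and expansion of the double series\<close>

text \<open>A term of \<open>F(s,t)\<close> with its outer power of \<open>z\<close> included, so
  that it is holomorphic in the parameters as a whole.\<close>

definition gkz_summand :: "complex \<Rightarrow> complex \<Rightarrow> complex \<Rightarrow> complex \<Rightarrow> nat \<times> nat \<Rightarrow> complex" where
  "gkz_summand L a s t p = branch_power L (a - s - t) * gkz_term L (a - s - t) s t p"

text \<open>Each step divides by a number of modulus at least \<open>(n+1)/2\<close>; the loss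
  against the factorial is a factor 2 per step.\<close>

lemma norm_rGamma_add_nat_le:
  assumes "norm b \<le> 1/8"
  shows "norm (rGamma (1 + b + of_nat n)) \<le> norm (rGamma (1 + b :: complex)) * 2 ^ n / fact n"
proof (induction n)
  case (Suc n)
  define x where "x = 1 + b + of_nat n"
  have "of_nat (Suc n) = norm (of_nat (Suc n) :: complex)" by (simp only: norm_of_nat)
  also have "of_nat (Suc n) = x - b" by (simp add: x_def)
  also have "norm \<dots> \<le> norm x + norm b" by (rule norm_triangle_ineq4)
  finally have x: "norm x \<ge> of_nat (Suc n) / 2" using assms by simp
  have "of_nat (Suc n) / 2 * norm (rGamma (x + 1)) \<le> norm x * norm (rGamma (x + 1))"
    using x by (intro mult_right_mono) auto
  also have "\<dots> = norm (rGamma x)"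
    using rGamma_plus1[of x] by (metis norm_mult)
  also have "\<dots> \<le> norm (rGamma (1 + b)) * 2 ^ n / fact n"
    using Suc by (simp add: x_def)
  finally have "norm (rGamma (x + 1)) \<le> (norm (rGamma (1 + b)) * 2 ^ n / fact n) / (of_nat (Suc n) / 2)"
    by (subst pos_le_divide_eq) (simp_all add: mult.commute)
  also have "\<dots> = norm (rGamma (1 + b)) * 2 ^ Suc n / fact (Suc n)"
    by (simp add: divide_simps)
  finally show ?case by (simp add: x_def add_ac)
qed auto

lemma norm_rGamma_diff_nat_le:
  assumes "norm a \<le> 1"
  shows "norm (rGamma (1 + a - of_nat n)) \<le> norm (rGamma (1 + a :: complex)) * fact n"
proof (induction n)
  case (Suc n)
  define x where "x = a - of_nat n"
  have x: "norm x \<le> of_nat (Suc n)"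
    using norm_triangle_ineq4[of a "of_nat n"] assms by (simp add: x_def)
  have "norm (rGamma x) = norm x * norm (rGamma (x + 1))"
    using rGamma_plus1[of x] by (metis norm_mult)
  also have "\<dots> \<le> of_nat (Suc n) * (norm (rGamma (1 + a)) * fact n)"
    using x Suc by (intro mult_mono) (auto simp: x_def algebra_simps)
  finally show ?case by (simp add: x_def algebra_simps)
qed auto

text \<open>The estimate \<open>binomial \<le> 2^n\<close> is used twice:
  \<open>(2N)! \<le> 4^N N!^2\<close> and \<open>N! \<le> 2^N m! n!\<close> with
  \<open>N = m + n\<close>.\<close>

lemma fact_double_le: "fact (2 * (m + n)) \<le> (16 ^ (m + n) * (fact m * fact n) ^ 2 :: real)"
proof -
  define N where "N = m + n"
  have choose: "real (n choose k) \<le> 2 ^ n" for n k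
    using of_nat_mono[OF binomial_le_pow2[of n k], where 'a = real] by simp
  have "(fact N :: real) = real (N choose m) * (fact m * fact n)"
    using binomial_fact[of m N, where 'a = real] by (simp add: N_def)
  also have "\<dots> \<le> 2 ^ N * (fact m * fact n)"
    by (intro mult_right_mono choose) simp
  finally have N: "(fact N :: real) \<le> 2 ^ N * (fact m * fact n)" .
  have "(fact (2 * N) :: real) = real ((2 * N) choose N) * (fact N * fact N)"
    using binomial_fact[of N "2 * N", where 'a = real] by simp
  also have "\<dots> \<le> 2 ^ (2 * N) * ((2 ^ N * (fact m * fact n)) * (2 ^ N * (fact m * fact n)))"
    by (intro mult_mono choose N) auto
  also have "\<dots> = (2 ^ (2 * N) * 2 ^ N * 2 ^ N) * (fact m * fact n) ^ 2"
    by (simp add: power2_eq_square)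
  also have "2 ^ (2 * N) * 2 ^ N * 2 ^ N = (16 ^ N :: real)"
    by (simp add: power_mult power_mult_distrib[symmetric])
  finally show ?thesis by (simp add: N_def)
qed

text \<open>The growth \<open>(2(m+n))!\<close> of the middle factor is absorbed by
  \<open>(m! n!)^2\<close> in the denominator, leaving \<open>2 * 16 / |z|^2\<close> per step. The
  constant is uniform in \<open>s\<close> and \<open>t\<close>, as the M-test requires.\<close>

lemma gkz_summand_bound:
  assumes a: "norm a \<le> 1/2"
  obtains C where "\<And>s t m n. norm s \<le> 1/8 \<Longrightarrow> norm t \<le> 1/8 \<Longrightarrow>
    norm (gkz_summand L a s t (m, n)) \<le> C * (32 / norm (exp L) ^ 2) ^ (m + n)"
proof -
  obtain K where K: "\<And>x :: complex. norm x \<le> 1 \<Longrightarrow> norm (rGamma (1 + x)) \<le> K"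
  proof -
    have "compact ((\<lambda>x :: complex. rGamma (1 + x)) ` cball 0 1)"
      by (intro compact_continuous_image holomorphic_on_imp_continuous_on holomorphic_intros) auto
    thus ?thesis using that
      by (metis (no_types, lifting) bounded_iff compact_imp_bounded image_eqI mem_cball_0)
  qed
  have K0: "K \<ge> 0" by (rule order_trans[OF norm_ge_zero K[of 0]]) simp
  define z where "z = norm (exp L)"
  have z: "z > 0" by (simp add: z_def)
  have "norm (gkz_summand L a s t (m, n)) \<le> (exp (norm L) * K ^ 3) * (32 / z ^ 2) ^ (m + n)"
    if st: "norm s \<le> 1/8" "norm t \<le> 1/8" for s t m n
  proof -
    define b where "b = a - s - t"
    have b: "norm b \<le> 1"
      using norm_triangle_ineq4[of "a - s" t] norm_triangle_ineq4[of a s] a st by (simp add: b_def)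
    have 1: "norm (branch_power L b) \<le> exp (norm L)"
    proof -
      have "Re (b * L) \<le> norm b * norm L"
        using complex_Re_le_cmod[of "b * L"] by (simp add: norm_mult)
      also have "\<dots> \<le> 1 * norm L" using b by (intro mult_right_mono) auto
      finally show ?thesis by (simp add: branch_power_def)
    qed
    have 2: "norm (branch_power L (- 2 * (of_nat m + of_nat n))) = (1 / z ^ 2) ^ (m + n)"
    proof -
      have "branch_power L (- 2 * (of_nat m + of_nat n)) = inverse (exp (of_nat (2 * (m + n)) * L))"
        by (simp add: branch_power_def exp_minus[symmetric] algebra_simps)
      also have "exp (of_nat (2 * (m + n)) * L) = exp L ^ (2 * (m + n))"
        by (rule exp_of_nat_mult)
      finally have eq: "branch_power L (- 2 * (of_nat m + of_nat n)) = inverse (exp L ^ (2 * (m + n)))" .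
      show ?thesis
        unfolding eq z_def
        by (simp only: norm_inverse norm_power power_mult power_one_over inverse_eq_divide norm_divide norm_one)
    qed
    have 3: "norm (rGamma (1 + s + of_nat n)) \<le> K * 2 ^ n / fact n"
      using norm_rGamma_add_nat_le[OF st(1), of n] K[of s] st
      by (elim order_trans) (auto intro!: divide_right_mono mult_right_mono)
    have 4: "norm (rGamma (1 + t + of_nat m)) \<le> K * 2 ^ m / fact m"
      using norm_rGamma_add_nat_le[OF st(2), of m] K[of t] st
      by (elim order_trans) (auto intro!: divide_right_mono mult_right_mono)
    have 5: "norm (rGamma (1 + b - 2 * of_nat m - 2 * of_nat n)) \<le> K * (16 ^ (m + n) * (fact m * fact n) ^ 2)"
    proof -
      have "1 + b - 2 * of_nat m - 2 * of_nat n = 1 + b - of_nat (2 * (m + n))"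
        by simp
      hence "norm (rGamma (1 + b - 2 * of_nat m - 2 * of_nat n)) \<le> norm (rGamma (1 + b)) * fact (2 * (m + n))"
        using norm_rGamma_diff_nat_le[OF b, of "2 * (m + n)"] by (simp only:)
      also have "\<dots> \<le> K * (16 ^ (m + n) * (fact m * fact n) ^ 2)"
        using K[OF b] K0 fact_double_le[of m n] by (intro mult_mono) auto
      finally show ?thesis .
    qed
    have "norm (gkz_summand L a s t (m, n)) =
       norm (branch_power L b) * (norm (branch_power L (- 2 * (of_nat m + of_nat n))) *
       norm (rGamma (1 + s + of_nat n)) * norm (rGamma (1 + b - 2 * of_nat m - 2 * of_nat n)) *
       norm (rGamma (1 + t + of_nat m)) / (fact m * fact n))"
      by (simp add: gkz_summand_def gkz_term_def norm_mult norm_divide b_def[symmetric])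
    also have "\<dots> \<le> exp (norm L) * ((1 / z ^ 2) ^ (m + n) * (K * 2 ^ n / fact n) *
       (K * (16 ^ (m + n) * (fact m * fact n) ^ 2)) * (K * 2 ^ m / fact m) / (fact m * fact n))"
      unfolding 2 using 1 3 4 5 K0 z by (intro mult_mono divide_right_mono) auto
    also have "\<dots> = (exp (norm L) * K ^ 3) * ((1 / z ^ 2) ^ (m + n) * (2 ^ n * 2 ^ m) * 16 ^ (m + n))"
      by (simp add: field_simps power2_eq_square power3_eq_cube)
    also have "(1 / z ^ 2) ^ (m + n) * (2 ^ n * 2 ^ m) * 16 ^ (m + n) = (32 / z ^ 2) ^ (m + n)"
    proof -
      have "(2::real) ^ n * 2 ^ m = 2 ^ (m + n)" by (simp add: power_add)
      thus ?thesis by (simp only: power_mult_distrib[symmetric]) simp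
    qed
    finally show ?thesis .
  qed
  thus ?thesis by (rule that[unfolded z_def[symmetric]])
qed

section \<open>Termwise Taylor expansion and summation along antidiagonals\<close>

lemma summable_on_double_geometric:
  fixes r :: real
  assumes "0 \<le> r" "r < 1"
  shows "(\<lambda>(m, n). C * r ^ (m + n)) summable_on (UNIV :: (nat \<times> nat) set)"
proof -
  have g: "((\<lambda>n. r ^ n) has_sum (1 / (1 - r))) UNIV"
    using assms by (intro sums_nonneg_imp_has_sum geometric_sums) auto
  have "(\<lambda>(m, n). r ^ (m + n)) summable_on (SIGMA m:UNIV. (UNIV :: nat set))"
  proof (rule summable_on_SigmaI)
    show "((\<lambda>n. case (m, n) of (m, n) \<Rightarrow> r ^ (m + n)) has_sum (r ^ m * (1 / (1 - r)))) UNIV" for m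
      using has_sum_cmult_right[OF g, of "r ^ m"] by (simp add: power_add)
    show "(\<lambda>m. r ^ m * (1 / (1 - r))) summable_on (UNIV :: nat set)"
      by (intro summable_on_cmult_left has_sum_imp_summable[OF g])
  qed (use assms in auto)
  hence "(\<lambda>p. C * (case p of (m, n) \<Rightarrow> r ^ (m + n))) summable_on (UNIV :: (nat \<times> nat) set)"
    by (intro summable_on_cmult_right) simp
  thus ?thesis by (simp add: case_prod_unfold)
qed

text \<open>The M-test gives uniform convergence of the net of finite partial sums; derivatives of
  holomorphic functions then converge too, so Taylor coefficients may be summed term by
  term.\<close>

lemma infsum_has_fps_expansion:
  fixes f :: "'i \<Rightarrow> complex \<Rightarrow> complex"
  assumes r: "r > 0" and holo: "\<And>i. i \<in> I \<Longrightarrow> f i holomorphic_on ball 0 r"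
    and bound: "\<And>i x. i \<in> I \<Longrightarrow> x \<in> ball 0 r \<Longrightarrow> norm (f i x) \<le> M i"
    and M: "M summable_on I"
    and exp: "\<And>i. i \<in> I \<Longrightarrow> f i has_fps_expansion F i"
  obtains G where "(\<lambda>x. \<Sum>\<^sub>\<infinity>i\<in>I. f i x) has_fps_expansion G"
    "\<And>k. ((\<lambda>i. fps_nth (F i) k) has_sum fps_nth G k) I"
proof -
  define g where "g = (\<lambda>x. \<Sum>\<^sub>\<infinity>i\<in>I. f i x)"
  have lim: "uniform_limit (ball 0 r) (\<lambda>X x. \<Sum>i\<in>X. f i x) g (finite_subsets_at_top I)"
    unfolding g_def by (rule Weierstrass_m_test_general[OF bound M])
  have sub: "\<forall>\<^sub>F X in finite_subsets_at_top I. finite X \<and> X \<subseteq> I"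
    by (rule eventually_finite_subsets_at_top_weakI) auto
  have holo': "\<forall>\<^sub>F X in finite_subsets_at_top I. (\<lambda>x. \<Sum>i\<in>X. f i x) holomorphic_on ball 0 r"
    using sub by eventually_elim (auto intro!: holomorphic_intros holo)
  \<comment> \<open>The limit theorem asks for continuity on a closed ball, hence the smaller
    radius.\<close>
  have half: "cball 0 (r/2) \<subseteq> ball (0 :: complex) r" using r by auto
  have "g holomorphic_on ball 0 (r/2)"
  proof (rule holomorphic_uniform_limit)
    show "\<forall>\<^sub>F X in finite_subsets_at_top I. continuous_on (cball 0 (r/2)) (\<lambda>x. \<Sum>i\<in>X. f i x) \<and>
        (\<lambda>x. \<Sum>i\<in>X. f i x) holomorphic_on ball 0 (r/2)"
      using holo'
    proof eventually_elim
      case (elim X)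
      have "ball 0 (r/2) \<subseteq> ball (0 :: complex) r" using r by auto
      thus ?case using elim half by (meson holomorphic_on_imp_continuous_on holomorphic_on_subset)
    qed
    show "uniform_limit (cball 0 (r/2)) (\<lambda>X x. \<Sum>i\<in>X. f i x) g (finite_subsets_at_top I)"
      by (rule uniform_limit_on_subset[OF lim half])
  qed auto
  hence G: "g has_fps_expansion fps_expansion g 0"
    using r by (intro has_fps_expansion_fps_expansion[of "ball 0 (r/2)"]) auto
  have "((\<lambda>i. fps_nth (F i) k) has_sum fps_nth (fps_expansion g 0) k) I" for k
    unfolding has_sum_def
  proof (rule Lim_transform_eventually)
    show "((\<lambda>X. (deriv ^^ k) (\<lambda>x. \<Sum>i\<in>X. f i x) 0 / fact k) \<longlongrightarrow> fps_nth (fps_expansion g 0) k) (finite_subsets_at_top I)"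
      unfolding fps_nth_fps_expansion[OF G]
      by (intro tendsto_intros higher_deriv_complex_uniform_limit[OF lim holo']) (use r in auto)
    show "\<forall>\<^sub>F X in finite_subsets_at_top I. (deriv ^^ k) (\<lambda>x. \<Sum>i\<in>X. f i x) 0 / fact k = (\<Sum>i\<in>X. fps_nth (F i) k)"
      using sub
    proof eventually_elim
      case (elim X)
      have "(\<lambda>x. \<Sum>i\<in>X. f i x) has_fps_expansion (\<Sum>i\<in>X. F i)"
        using elim exp by (intro has_fps_expansion_sum) auto
      thus ?case
        by (subst fps_nth_fps_expansion[symmetric]) (auto simp: fps_sum_nth)
    qed
  qed
  thus ?thesis using that G by (simp add: g_def)
qed

lemma has_sum_antidiagonal:
  fixes f :: "nat \<times> nat \<Rightarrow> 'a :: {topological_comm_monoid_add, t3_space}"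
  assumes "(f has_sum S) UNIV"
  shows "((\<lambda>N. \<Sum>m\<le>N. f (m, N - m)) has_sum S) UNIV"
proof (rule has_sum_SigmaD)
  show "((\<lambda>(N, m). f (m, N - m)) has_sum S) (SIGMA N:UNIV. {..N})"
    using assms
    by (subst has_sum_reindex_bij_witness[where j = "\<lambda>(N, m). (m, N - m)" and i = "\<lambda>(m, n). (m + n, m)"
          and h = f and T = UNIV and s' = S]) auto
qed auto

text \<open>For \<open>m + n = N\<close>, \<open>1/(\<Gamma>(1+s+n) m!)\<close> is the binomial
  coefficient of \<open>N+s\<close> over \<open>m\<close> divided by \<open>\<Gamma>(N+s+1)\<close>,
  and likewise for \<open>t\<close>. Vandermonde sums the products to the binomial coefficient of
  \<open>2N+s+t\<close> over \<open>N\<close>.\<close>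

lemma gkz_antidiagonal:
  assumes st: "norm s \<le> 1/8" "norm t \<le> 1/8"
  shows "(\<Sum>m\<le>N. gkz_summand L a s t (m, N - m)) =
     branch_power L (a - s - t) * exp (- 2 * of_nat N * L) * rGamma (1 + (a - s - t) - 2 * of_nat N) *
     Gamma (2 * of_nat N + (s + t) + 1) * rGamma (of_nat N + 1) * rGamma (of_nat N + (s + t) + 1) *
     rGamma (of_nat N + s + 1) * rGamma (of_nat N + t + 1)"
proof -
  define K where "K = branch_power L (a - s - t) * exp (- 2 * of_nat N * L) * rGamma (1 + (a - s - t) - 2 * of_nat N)"
  define A where "A = of_nat N + s"
  define B where "B = of_nat N + t"
  have shift: "rGamma (1 + x + of_nat n) / fact m = ((of_nat (m + n) + x) gchoose m) * rGamma (of_nat (m + n) + x + 1)"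
    for x :: complex and m n
  proof -
    have "(of_nat (m + n) + x) gchoose m = pochhammer (1 + x + of_nat n) m / fact m"
      by (simp add: gbinomial_pochhammer' algebra_simps)
    thus ?thesis
      using pochhammer_rGamma[of "1 + x + of_nat n" m] by (simp add: algebra_simps)
  qed
  have "gkz_summand L a s t (m, N - m) =
     K * rGamma (A + 1) * rGamma (B + 1) * ((A gchoose m) * (B gchoose (N - m)))" if "m \<in> {0..N}" for m
  proof -
    define n where "n = N - m"
    have N: "N = m + n" using that by (simp add: n_def)
    have "branch_power L (- 2 * (of_nat m + of_nat n)) = exp (- 2 * of_nat N * L)"
      by (simp add: branch_power_def N)
    hence "gkz_summand L a s t (m, n) = K * (rGamma (1 + s + of_nat n) / fact m) * (rGamma (1 + t + of_nat m) / fact n)"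
      by (simp add: gkz_summand_def gkz_term_def K_def) (simp add: N algebra_simps)
    also have "\<dots> = K * ((A gchoose m) * rGamma (A + 1)) * ((B gchoose n) * rGamma (B + 1))"
      using shift[of s n m] shift[of t m n] by (simp add: A_def B_def N add_ac)
    finally show ?thesis by (simp add: n_def)
  qed
  hence "(\<Sum>m\<le>N. gkz_summand L a s t (m, N - m)) = K * rGamma (A + 1) * rGamma (B + 1) * ((A + B) gchoose N)"
    by (simp add: atLeast0AtMost[symmetric] gbinomial_Vandermonde[symmetric] sum_distrib_left)
  also have "(A + B) gchoose N = rGamma (of_nat N + 1) * rGamma (of_nat N + (s + t) + 1) * Gamma (2 * of_nat N + (s + t) + 1)"
  proof -
    have "2 * of_nat N + (s + t) + 1 \<notin> \<int>\<^sub>\<le>\<^sub>0"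
      using Re_bounds[OF st(1)] Re_bounds[OF st(2)] by (intro not_nonpos_Ints_of_Re_pos) auto
    hence nz: "rGamma (2 * of_nat N + (s + t) + 1) \<noteq> 0"
      by (simp add: rGamma_eq_zero_iff)
    have 1: "(A + B) gchoose N = pochhammer (of_nat N + (s + t) + 1) N / fact N"
      by (simp add: gbinomial_pochhammer' A_def B_def algebra_simps)
    have 2: "rGamma (of_nat N + (s + t) + 1) = pochhammer (of_nat N + (s + t) + 1) N * rGamma (2 * of_nat N + (s + t) + 1)"
      using pochhammer_rGamma[of "of_nat N + (s + t) + 1" N] by (simp add: algebra_simps)
    have 3: "rGamma (of_nat N + 1 :: complex) = 1 / fact N"
      by (simp add: rGamma_inverse_Gamma Gamma_fact[symmetric] add_ac inverse_eq_divide)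
    show ?thesis
      unfolding 1 2 3 Gamma_def using nz by simp
  qed
  finally show ?thesis
    by (simp add: K_def A_def B_def mult_ac)
qed

lemma summable_on_gkz_bound:
  assumes "8 < norm (exp (L :: complex))"
  shows "(\<lambda>(m, n). C * (32 / norm (exp L) ^ 2) ^ (m + n)) summable_on UNIV"
proof -
  have "8 ^ 2 < norm (exp L) ^ 2" using assms by (intro power_strict_mono) auto
  hence "32 / norm (exp L) ^ 2 < 1" by (simp add: divide_simps)
  thus ?thesis by (intro summable_on_double_geometric) auto
qed

lemma gkz_term_summable:
  assumes L: "8 < norm (exp L)" and a: "norm a \<le> 1/2" and st: "norm s \<le> 1/8" "norm t \<le> 1/8"
    and b: "b = a - s - t"
  shows "gkz_term L b s t summable_on UNIV"
proof -
  obtain C where C: "\<And>s t m n. norm s \<le> 1/8 \<Longrightarrow> norm t \<le> 1/8 \<Longrightarrow>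
    norm (gkz_summand L a s t (m, n)) \<le> C * (32 / norm (exp L) ^ 2) ^ (m + n)"
    using gkz_summand_bound[OF a, of L] by metis
  have "(\<lambda>(m, n). C * (32 / norm (exp L) ^ 2) ^ (m + n)) summable_on UNIV"
    by (rule summable_on_gkz_bound[OF L])
  hence "(\<lambda>p. norm (gkz_summand L a s t p)) summable_on UNIV"
    by (rule Infinite_Sum.abs_summable_on_comparison_test') (use C[OF st] in auto)
  hence "gkz_summand L a s t summable_on UNIV"
    by (rule abs_summable_summable)
  hence "(\<lambda>p. inverse (branch_power L b) * gkz_summand L a s t p) summable_on UNIV"
    by (rule summable_on_cmult_right)
  thus ?thesis
    by (simp add: gkz_summand_def b branch_power_def mult.assoc[symmetric])
qed

text \<open>Restricts \<open>F\<close> to the line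
  \<open>(\<alpha>\<epsilon>, \<beta>\<epsilon>)\<close>. The bounds on \<open>\<alpha>\<close> and
  \<open>\<beta>\<close> keep both parameters in the disc where the summands are uniformly
  dominated.\<close>

lemma gkz_series_has_fps_expansion:
  assumes L: "8 < norm (exp L)" and a: "norm a \<le> 1/2" and \<alpha>\<beta>: "norm \<alpha> \<le> 1" "norm \<beta> \<le> 1"
    and J: "\<And>N. (\<lambda>\<epsilon>. \<Sum>m\<le>N. gkz_summand L a (\<alpha> * \<epsilon>) (\<beta> * \<epsilon>) (m, N - m)) has_fps_expansion J N"
  obtains G where "(\<lambda>\<epsilon>. gkz_series L (a - \<alpha> * \<epsilon> - \<beta> * \<epsilon>) (\<alpha> * \<epsilon>) (\<beta> * \<epsilon>)) has_fps_expansion G"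
    "\<And>k. (\<lambda>N. fps_nth (J N) k) sums fps_nth G k"
proof -
  define f where "f = (\<lambda>p \<epsilon>. gkz_summand L a (\<alpha> * \<epsilon>) (\<beta> * \<epsilon>) p)"
  obtain C where C: "\<And>s t m n. norm s \<le> 1/8 \<Longrightarrow> norm t \<le> 1/8 \<Longrightarrow>
    norm (gkz_summand L a s t (m, n)) \<le> C * (32 / norm (exp L) ^ 2) ^ (m + n)"
    using gkz_summand_bound[OF a, of L] by metis
  have M: "(\<lambda>(m, n). C * (32 / norm (exp L) ^ 2) ^ (m + n)) summable_on UNIV"
    by (rule summable_on_gkz_bound[OF L])
  have small: "norm (\<gamma> * \<epsilon>) \<le> 1/8" if "\<epsilon> \<in> ball 0 (1/8)" "norm \<gamma> \<le> 1" for \<gamma> \<epsilon> :: complex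
    using mult_mono[OF that(2), of "norm \<epsilon>" "1/8"] that(1) by (simp add: norm_mult)
  have holo: "f p holomorphic_on ball 0 (1/8)" for p
  proof (cases p)
    case (Pair m n)
    show ?thesis
      unfolding Pair f_def gkz_summand_def gkz_term_def branch_power_def prod.case
      by (intro holomorphic_intros) auto
  qed
  have exp: "f p has_fps_expansion fps_expansion (f p) 0" for p
    using holo[of p] by (intro has_fps_expansion_fps_expansion[of "ball 0 (1/8)"]) auto
  obtain G where G: "(\<lambda>x. \<Sum>\<^sub>\<infinity>p\<in>UNIV. f p x) has_fps_expansion G"
    "\<And>k. ((\<lambda>p. fps_nth (fps_expansion (f p) 0) k) has_sum fps_nth G k) UNIV"
  proof (rule infsum_has_fps_expansion[where r = "1/8", OF _ holo _ M exp])
    show "norm (f p \<epsilon>) \<le> (case p of (m, n) \<Rightarrow> C * (32 / norm (exp L) ^ 2) ^ (m + n))"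
      if "\<epsilon> \<in> ball 0 (1/8)" for p \<epsilon>
      using C[OF small[OF that \<alpha>\<beta>(1)] small[OF that \<alpha>\<beta>(2)]] by (cases p) (auto simp: f_def)
  qed auto
  have "J N = (\<Sum>m\<le>N. fps_expansion (f (m, N - m)) 0)" for N
    by (rule has_fps_expansion_unique[OF J has_fps_expansion_sum[OF exp]]) (simp add: f_def)
  hence "(\<lambda>N. fps_nth (J N) k) sums fps_nth G k" for k
    using has_sum_imp_sums[OF has_sum_antidiagonal[OF G(2)[of k]]] by (simp add: fps_sum_nth)
  moreover have "(\<lambda>x. \<Sum>\<^sub>\<infinity>p\<in>UNIV. f p x) =
      (\<lambda>\<epsilon>. gkz_series L (a - \<alpha> * \<epsilon> - \<beta> * \<epsilon>) (\<alpha> * \<epsilon>) (\<beta> * \<epsilon>))"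
    by (simp add: f_def gkz_summand_def gkz_series_def infsum_cmult_right')
  ultimately show ?thesis using that G(1) by simp
qed

section \<open>Reduction of the two-parameter family to one-parameter jets\<close>

lemma has_fps_expansion_transfer:
  assumes "f has_fps_expansion F" "r > 0" "\<And>x. norm x \<le> r \<Longrightarrow> f x = g x"
  shows "g has_fps_expansion (F :: complex fps)"
proof -
  have "eventually (\<lambda>x. f x = g x) (nhds 0)"
    using eventually_nhds_0_norm_le[OF assms(2)] by (rule eventually_mono) (rule assms(3))
  thus ?thesis
    using has_fps_expansion_cong[of f g F F] assms(1) by simp
qed

text \<open>
  Compares the antidiagonal sums at \<open>(\<epsilon>,\<epsilon>)\<close> and \<open>(\<epsilon>,-\<epsilon>)\<close>, where the lower Gamma factors are
  \<open>R(0) R(2\<epsilon>) R(\<epsilon>)\<^sup>2\<close> and \<open>R(0)\<^sup>2 R(\<epsilon>) R(-\<epsilon>)\<close>, with the one-parameter term \<open>M R\<^sup>4\<close>.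
\<close>

lemma polarized_jets:
  fixes M R :: "complex fps"
  assumes "G = M * fps_const (fps_nth R 0) * Abs_fps (\<lambda>n. 2 ^ n * fps_nth R n) * R * R"
    and "H = fps_const (fps_nth M 0 * fps_nth R 0 * fps_nth R 0) * R * Abs_fps (\<lambda>n. (-1) ^ n * fps_nth R n)"
    and "q = M * R ^ 4"
  shows "fps_nth G 0 = fps_nth q 0" "fps_nth G 1 = fps_nth q 1"
    "fps_nth H 0 = fps_nth q 0" "fps_nth H 1 = 0"
    "fps_nth G 2 - fps_nth H 2 = fps_nth q 2"
proof -
  define m where "m = fps_nth M"
  define r where "r = fps_nth R"
  note nth = fps_mult_nth_0 fps_mult_nth_1 fps_mult_nth_2 fps_nth_fps_const fps_nth_Abs_fps
    m_def[symmetric] r_def[symmetric]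
  note defs = assms power4_eq_xxxx
  \<comment> \<open>In degree 2,
    \<open>(6 r0 r2 + 5 r1^2) - (2 r0 r2 - r1^2) = 4 r0 r2 + 6 r1^2\<close>, which is the
    contribution of \<open>R^4\<close>.\<close>
  have "fps_nth G 0 = m 0 * r 0 * r 0 * r 0 * r 0"
    "fps_nth G 1 = m 1 * r 0 * r 0 * r 0 * r 0 + 4 * m 0 * r 0 * r 0 * r 0 * r 1"
    "fps_nth G 2 = m 2 * r 0 * r 0 * r 0 * r 0 + 4 * m 1 * r 0 * r 0 * r 0 * r 1
       + m 0 * r 0 * r 0 * (6 * r 0 * r 2 + 5 * r 1 * r 1)"
    "fps_nth H 0 = m 0 * r 0 * r 0 * r 0 * r 0" "fps_nth H 1 = 0"
    "fps_nth H 2 = m 0 * r 0 * r 0 * (2 * r 0 * r 2 - r 1 * r 1)"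
   and "fps_nth q 0 = m 0 * r 0 * r 0 * r 0 * r 0"
    "fps_nth q 1 = m 1 * r 0 * r 0 * r 0 * r 0 + 4 * m 0 * r 0 * r 0 * r 0 * r 1"
    "fps_nth q 2 = m 2 * r 0 * r 0 * r 0 * r 0 + 4 * m 1 * r 0 * r 0 * r 0 * r 1
       + m 0 * r 0 * r 0 * (4 * r 0 * r 2 + 6 * r 1 * r 1)"
    unfolding defs unfolding nth by simp_all algebra+
  thus "fps_nth G 0 = fps_nth q 0" "fps_nth G 1 = fps_nth q 1"
    "fps_nth H 0 = fps_nth q 0" "fps_nth H 1 = 0"
    "fps_nth G 2 - fps_nth H 2 = fps_nth q 2"
    by (simp_all add: ring_distribs)
qed

text \<open>The antidiagonal sum at \<open>s + t = 2\<tau>\<close> with the four lower Gamma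
  arguments replaced by their mean. Compared with \<open>qcoeff\<close>, the exponent
  \<open>a\<close> is general and the power of \<open>y\<close> is retained.\<close>

definition gkz_qterm :: "complex \<Rightarrow> complex \<Rightarrow> nat \<Rightarrow> complex \<Rightarrow> complex" where
  "gkz_qterm L a N \<tau> = branch_power L (a - 2 * \<tau>) * exp (- 2 * of_nat N * L) *
     rGamma (1 + (a - 2 * \<tau>) - 2 * of_nat N) * Gamma (2 * of_nat N + 2 * \<tau> + 1) *
     rGamma (of_nat N + \<tau> + 1) ^ 4"

text \<open>\<open>polarized_jets\<close> is applied for each \<open>N\<close> and summed. In terms
  of \<open>F(s,t)\<close>, the difference of the second coefficients along
  \<open>(\<epsilon>,\<epsilon>)\<close> and \<open>(\<epsilon>,-\<epsilon>)\<close> is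
  \<open>2 F_st\<close> at the origin.\<close>

lemma gkz_series_jets:
  assumes L: "8 < norm (exp L)" and a: "norm a \<le> 1/2"
    and q: "\<And>N. gkz_qterm L a N has_fps_expansion q N"
  obtains G H where
    "(\<lambda>\<epsilon>. gkz_series L (a - 2 * \<epsilon>) \<epsilon> \<epsilon>) has_fps_expansion G"
    "(\<lambda>\<epsilon>. gkz_series L a \<epsilon> (- \<epsilon>)) has_fps_expansion H"
    "fps_nth H 0 = fps_nth G 0" "fps_nth H 1 = 0"
    "(\<lambda>N. fps_nth (q N) 0) sums fps_nth G 0"
    "(\<lambda>N. fps_nth (q N) 1) sums fps_nth G 1"
    "(\<lambda>N. fps_nth (q N) 2) sums (fps_nth G 2 - fps_nth H 2)"
proof -
  define m where "m = (\<lambda>N \<tau>. branch_power L (a - 2 * \<tau>) * exp (- 2 * of_nat N * L) *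
     rGamma (1 + (a - 2 * \<tau>) - 2 * of_nat N) * Gamma (2 * of_nat N + 2 * \<tau> + 1))"
  define \<rho> where "\<rho> = (\<lambda>N \<tau>. rGamma (of_nat N + \<tau> + 1 :: complex))"
  define M where "M = (\<lambda>N. fps_expansion (m N) 0)"
  define R where "R = (\<lambda>N. fps_expansion (\<rho> N) 0)"
  have M: "m N has_fps_expansion M N" for N
    unfolding M_def
  proof (rule has_fps_expansion_fps_expansion[of "ball 0 (1/8)"])
    show "m N holomorphic_on ball 0 (1/8)"
      unfolding m_def branch_power_def using Gamma_2N_nonpole by (auto intro!: holomorphic_intros)
  qed auto
  have R: "\<rho> N has_fps_expansion R N" for N
    unfolding R_def \<rho>_def
    by (rule has_fps_expansion_fps_expansion[of UNIV]) (auto intro!: holomorphic_intros)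
  have M0: "fps_nth (M N) 0 = m N 0" and R0: "fps_nth (R N) 0 = \<rho> N 0" for N
    using has_fps_expansion_imp_0_eq_fps_nth_0[OF M] has_fps_expansion_imp_0_eq_fps_nth_0[OF R] by simp_all
  define R2 where "R2 = (\<lambda>N. Abs_fps (\<lambda>n. 2 ^ n * fps_nth (R N) n))"
  define R' where "R' = (\<lambda>N. Abs_fps (\<lambda>n. (-1) ^ n * fps_nth (R N) n))"
  define G where "G = (\<lambda>N. M N * fps_const (\<rho> N 0) * R2 N * R N * R N)"
  define H where "H = (\<lambda>N. fps_const (m N 0 * \<rho> N 0 * \<rho> N 0) * R N * R' N)"
  have R2: "(\<lambda>\<tau>. \<rho> N (2 * \<tau>)) has_fps_expansion R2 N" for N
    unfolding R2_def by (rule has_fps_expansion_scale_arg[OF R])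
  have R': "(\<lambda>\<tau>. \<rho> N (- \<tau>)) has_fps_expansion R' N" for N
    unfolding R'_def using has_fps_expansion_scale_arg[OF R, where c = "-1"] by simp
  have G: "(\<lambda>\<epsilon>. \<Sum>k\<le>N. gkz_summand L a (1 * \<epsilon>) (1 * \<epsilon>) (k, N - k)) has_fps_expansion G N" for N
  proof -
    have "(\<lambda>\<tau>. m N \<tau> * \<rho> N 0 * \<rho> N (2 * \<tau>) * \<rho> N \<tau> * \<rho> N \<tau>) has_fps_expansion G N"
      unfolding G_def by (intro has_fps_expansion_mult has_fps_expansion_const M R R2)
    thus ?thesis
    proof (rule has_fps_expansion_transfer[where r = "1/8"])
      show "m N \<tau> * \<rho> N 0 * \<rho> N (2 * \<tau>) * \<rho> N \<tau> * \<rho> N \<tau> =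
          (\<Sum>k\<le>N. gkz_summand L a (1 * \<tau>) (1 * \<tau>) (k, N - k))" if "norm \<tau> \<le> 1/8" for \<tau>
      proof -
        have eq: "a - \<tau> - \<tau> = a - 2 * \<tau>" "\<tau> + \<tau> = 2 * \<tau>" by simp_all
        show ?thesis
          unfolding mult_1 gkz_antidiagonal[OF that that] eq m_def \<rho>_def by (simp only: add_0_right mult_ac)
      qed
    qed auto
  qed
  have H: "(\<lambda>\<epsilon>. \<Sum>k\<le>N. gkz_summand L a (1 * \<epsilon>) (-1 * \<epsilon>) (k, N - k)) has_fps_expansion H N" for N
  proof -
    have "(\<lambda>\<tau>. (m N 0 * \<rho> N 0 * \<rho> N 0) * \<rho> N \<tau> * \<rho> N (- \<tau>)) has_fps_expansion H N"
      unfolding H_def by (intro has_fps_expansion_mult has_fps_expansion_const R R')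
    thus ?thesis
    proof (rule has_fps_expansion_transfer[where r = "1/8"])
      show "(m N 0 * \<rho> N 0 * \<rho> N 0) * \<rho> N \<tau> * \<rho> N (- \<tau>) =
          (\<Sum>k\<le>N. gkz_summand L a (1 * \<tau>) (-1 * \<tau>) (k, N - k))" if "norm \<tau> \<le> 1/8" for \<tau>
      proof -
        have eq: "a - \<tau> - - \<tau> = a" "\<tau> + - \<tau> = 0" "-1 * \<tau> = - \<tau>" "a - 2 * 0 = a"
          "norm (- \<tau>) \<le> 1/8" using that by simp_all
        show ?thesis
          unfolding mult_1 eq gkz_antidiagonal[OF that eq(5)] m_def \<rho>_def
          by (simp only: eq add_0_right mult_zero_right mult_zero_left mult_ac)
      qed
    qed auto
  qed
  have qM: "q N = M N * R N ^ 4" for N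
  proof (rule has_fps_expansion_unique[OF q])
    show "(\<lambda>\<tau>. m N \<tau> * \<rho> N \<tau> ^ 4) has_fps_expansion M N * R N ^ 4"
      by (rule has_fps_expansion_mult[OF M has_fps_expansion_power[OF R]])
  qed (simp add: gkz_qterm_def m_def \<rho>_def)
  have jets: "fps_nth (G N) 0 = fps_nth (q N) 0" "fps_nth (G N) 1 = fps_nth (q N) 1"
    "fps_nth (H N) 0 = fps_nth (q N) 0" "fps_nth (H N) 1 = 0"
    "fps_nth (G N) 2 - fps_nth (H N) 2 = fps_nth (q N) 2" for N
    by (rule polarized_jets[OF _ _ qM]; simp add: G_def H_def R2_def R'_def M0 R0)+
  obtain G' where G': "(\<lambda>\<epsilon>. gkz_series L (a - 1 * \<epsilon> - 1 * \<epsilon>) (1 * \<epsilon>) (1 * \<epsilon>)) has_fps_expansion G'"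
    "\<And>k. (\<lambda>N. fps_nth (G N) k) sums fps_nth G' k"
    by (rule gkz_series_has_fps_expansion[OF L a _ _ G]) auto
  obtain H' where H': "(\<lambda>\<epsilon>. gkz_series L (a - 1 * \<epsilon> - (-1) * \<epsilon>) (1 * \<epsilon>) (-1 * \<epsilon>)) has_fps_expansion H'"
    "\<And>k. (\<lambda>N. fps_nth (H N) k) sums fps_nth H' k"
    by (rule gkz_series_has_fps_expansion[OF L a _ _ H]) auto
  show ?thesis
  proof (rule that[of G' H'])
    show "(\<lambda>\<epsilon>. gkz_series L (a - 2 * \<epsilon>) \<epsilon> \<epsilon>) has_fps_expansion G'"
    proof -
      have "a - \<epsilon> - \<epsilon> = a - 2 * \<epsilon>" for \<epsilon> by simp
      thus ?thesis using G'(1) by (simp only: mult_1)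
    qed
    show "(\<lambda>\<epsilon>. gkz_series L a \<epsilon> (- \<epsilon>)) has_fps_expansion H'"
      using H'(1) by simp
    show "fps_nth H' 0 = fps_nth G' 0"
      using H'(2)[of 0] G'(2)[of 0] unfolding jets by (rule sums_unique2)
    show "fps_nth H' 1 = 0"
      using H'(2)[of 1] sums_zero unfolding jets by (rule sums_unique2)
    show "(\<lambda>N. fps_nth (q N) 0) sums fps_nth G' 0" "(\<lambda>N. fps_nth (q N) 1) sums fps_nth G' 1"
      using G'(2)[of 0] G'(2)[of 1] unfolding jets by simp_all
    show "(\<lambda>N. fps_nth (q N) 2) sums (fps_nth G' 2 - fps_nth H' 2)"
      using sums_diff[OF G'(2)[of 2] H'(2)[of 2]] unfolding jets .
  qed
qed

lemma gkz_qterm_half: "gkz_qterm L (1/2) N \<tau> = qcoeff L N \<tau> * (16 * exp (- 2 * L)) ^ N"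
proof -
  have "exp (- 2 * of_nat N * L) = exp (- 2 * L) ^ N"
    by (simp add: exp_of_nat_mult[symmetric] mult_ac)
  moreover have "1 + (1/2 - 2 * \<tau>) - 2 * of_nat N = 3/2 - 2 * \<tau> - 2 * of_nat N"
    by simp
  ultimately show ?thesis
    unfolding gkz_qterm_def qcoeff_def branch_power_def by (simp only: power_mult_distrib) simp
qed

text \<open>The factor \<open>1/2 - 2(N + \<tau>)\<close> is the exponent of \<open>z\<close> in the
  \<open>N\<close>-th term for \<open>a = 1/2\<close>, so this is differentiation in
  \<open>z\<close>; it comes from \<open>rGamma x = x * rGamma (x + 1)\<close>.\<close>

lemma gkz_qterm_minus_half:
  "gkz_qterm L (-1/2) N \<tau> = exp (- L) * ((1/2 - 2 * (of_nat N + \<tau>)) * gkz_qterm L (1/2) N \<tau>)"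
proof -
  define x where "x = 1/2 - 2 * (of_nat N + \<tau>)"
  have "branch_power L (-1/2 - 2 * \<tau>) = exp (- L) * branch_power L (1/2 - 2 * \<tau>)"
    by (simp add: branch_power_def exp_add[symmetric] algebra_simps)
  moreover have "rGamma x = x * rGamma (x + 1)"
    by (rule rGamma_plus1[symmetric])
  moreover have "1 + (-1/2 - 2 * \<tau>) - 2 * of_nat N = x" "1 + (1/2 - 2 * \<tau>) - 2 * of_nat N = x + 1"
    by (simp_all add: x_def field_simps)
  ultimately show ?thesis
    unfolding gkz_qterm_def x_def[symmetric] by (simp add: mult_ac)
qed

subsection \<open>The limits\<close>

lemma has_fps_expansion_imp_tendsto_quotient:
  assumes f: "f has_fps_expansion (F :: complex fps)" and F: "\<And>i. i < n \<Longrightarrow> fps_nth F i = 0"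
  shows "((\<lambda>x. f x / x ^ n) \<longlongrightarrow> fps_nth F n) (at 0)"
proof -
  have "(\<lambda>x. if x = 0 then fps_nth F n else f x / x ^ n) has_fps_expansion fps_shift n F"
  proof (cases "F = 0")
    case True
    hence "eventually (\<lambda>x. f x = 0) (nhds 0)"
      using f by (simp add: has_fps_expansion_0_iff)
    thus ?thesis
      unfolding True by (auto simp: has_fps_expansion_0_iff elim!: eventually_mono)
  next
    case False
    thus ?thesis
      using f F by (intro has_fps_expansion_shift subdegree_geI) auto
  qed
  hence "((\<lambda>x. if x = 0 then fps_nth F n else f x / x ^ n) \<longlongrightarrow> fps_nth F n) (at 0)"
    using has_fps_expansion_imp_tendsto_0 by (force simp: tendsto_nhds_iff)
  thus ?thesis
    by (rule Lim_transform_eventually) (auto simp: eventually_at_filter)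
qed

text \<open>The columns of \<open>Q\<close> form the difference quotients
  \<open>(f2 - f1)/\<epsilon>\<close> and \<open>(f1 - 2 f2 + f4)/\<epsilon>^2\<close>. The
  hypotheses on low-order coefficients remove the poles.\<close>

lemma vector_matrix_mult_Q_tendsto:
  assumes f1: "f1 has_fps_expansion F1" and f2: "f2 has_fps_expansion F2" and f4: "f4 has_fps_expansion F4"
    and 0: "fps_nth F2 0 = fps_nth F1 0" "fps_nth F4 0 = fps_nth F1 0"
    and 1: "fps_nth F2 1 = 0" "fps_nth F4 1 = - fps_nth F1 1"
  shows "((\<lambda>\<epsilon>. vector [f1 \<epsilon>, f2 \<epsilon>, f2 \<epsilon>, f4 \<epsilon>] v* Q \<epsilon>) \<longlongrightarrow>
    vector [fps_nth F1 0, - fps_nth F1 1, - fps_nth F1 1, fps_nth F1 2 - 2 * fps_nth F2 2 + fps_nth F4 2]) (at 0)"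
proof (rule vec_tendstoI)
  fix i :: 4
  have l1: "(f1 \<longlongrightarrow> fps_nth F1 0) (at 0)"
    using has_fps_expansion_imp_tendsto_quotient[OF f1, of 0] by simp
  have l2: "((\<lambda>\<epsilon>. (f2 \<epsilon> - f1 \<epsilon>) / \<epsilon>) \<longlongrightarrow> - fps_nth F1 1) (at 0)"
    using has_fps_expansion_imp_tendsto_quotient[OF has_fps_expansion_diff[OF f2 f1], of 1] 0 1 by simp
  have "(\<lambda>\<epsilon>. f1 \<epsilon> - 2 * f2 \<epsilon> + f4 \<epsilon>) has_fps_expansion F1 - fps_const 2 * F2 + F4"
    by (intro has_fps_expansion_add has_fps_expansion_diff has_fps_expansion_cmult_left f1 f2 f4)
  hence "((\<lambda>\<epsilon>. (f1 \<epsilon> - 2 * f2 \<epsilon> + f4 \<epsilon>) / \<epsilon> ^ 2) \<longlongrightarrow>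
      fps_nth (F1 - fps_const 2 * F2 + F4) 2) (at 0)"
    by (rule has_fps_expansion_imp_tendsto_quotient) (use 0 1 in \<open>auto simp: less_2_cases_iff\<close>)
  hence l4: "((\<lambda>\<epsilon>. (f1 \<epsilon> - 2 * f2 \<epsilon> + f4 \<epsilon>) / \<epsilon> ^ 2) \<longlongrightarrow>
      fps_nth F1 2 - 2 * fps_nth F2 2 + fps_nth F4 2) (at 0)"
    by simp
  have comp: "(vector [f1 \<epsilon>, f2 \<epsilon>, f2 \<epsilon>, f4 \<epsilon>] v* Q \<epsilon>) $ 1 = f1 \<epsilon>"
    "(vector [f1 \<epsilon>, f2 \<epsilon>, f2 \<epsilon>, f4 \<epsilon>] v* Q \<epsilon>) $ 2 = (f2 \<epsilon> - f1 \<epsilon>) / \<epsilon>"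
    "(vector [f1 \<epsilon>, f2 \<epsilon>, f2 \<epsilon>, f4 \<epsilon>] v* Q \<epsilon>) $ 3 = (f2 \<epsilon> - f1 \<epsilon>) / \<epsilon>"
    "(vector [f1 \<epsilon>, f2 \<epsilon>, f2 \<epsilon>, f4 \<epsilon>] v* Q \<epsilon>) $ 4 = (f1 \<epsilon> - 2 * f2 \<epsilon> + f4 \<epsilon>) / \<epsilon> ^ 2" for \<epsilon>
    by (simp_all add: vector_matrix_mult_def Q_def sum_4 vector_4 divide_inverse ring_distribs)
  have "i = 1 \<or> i = 2 \<or> i = 3 \<or> i = 4" by (rule exhaust_4)
  thus "((\<lambda>\<epsilon>. (vector [f1 \<epsilon>, f2 \<epsilon>, f2 \<epsilon>, f4 \<epsilon>] v* Q \<epsilon>) $ i) \<longlongrightarrow>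
    vector [fps_nth F1 0, - fps_nth F1 1, - fps_nth F1 1, fps_nth F1 2 - 2 * fps_nth F2 2 + fps_nth F4 2] $ i) (at 0)"
    using l1 l2 l4 by (elim disjE) (simp_all add: comp vector_4)
qed

lemma pairing_matrix_product:
  fixes p0 p1 p2 r0 r1 r2 :: complex
  assumes "P = vector [p0, p1, p1, p2]" and "P' = vector [r0, r1, r1, r2]"
  shows "(rowvector P :: complex ^ 4 ^ 1) ** pairing_matrix ** transpose (rowvector P' :: complex ^ 4 ^ 1) =
    mat (4 * of_real pi ^ 3 * p0 * r0 + of_real pi * (p0 * r2 + 2 * p1 * r1 + p2 * r0))"
  unfolding assms
  by (simp add: vec_eq_iff matrix_matrix_mult_def rowvector_def transpose_def pairing_matrix_def mat_def
      sum_4 vector_4 algebra_simps)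

theorem mainTheorem11:
  shows "\<exists>R::real. \<forall>z L :: complex. R < norm z \<and> exp L = z \<longrightarrow>
    (\<forall>\<^sub>F \<epsilon> in at 0. all_series_converge L \<epsilon>) \<and>
    (\<exists>P P' :: complex ^ 4.
       ((\<lambda>\<epsilon>. Phi L \<epsilon> v* Q \<epsilon>) \<longlongrightarrow> P) (at 0) \<and>
       ((\<lambda>\<epsilon>. Phi_dual L \<epsilon> v* Q \<epsilon>) \<longlongrightarrow> P') (at 0) \<and>
       (rowvector P :: complex ^ 4 ^ 1) ** pairing_matrix ** transpose (rowvector P' :: complex ^ 4 ^ 1) = mat 64)"
proof (intro exI[of _ 8] allI impI)
  \<comment> \<open>The radius 8 gives \<open>32/|z|^2 < 1/2\<close> for the domination and
    \<open>|y| = 16/|z|^2 < 1/4\<close> for the jets.\<close>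
  fix z L :: complex
  assume "8 < norm z \<and> exp L = z"
  hence L: "8 < norm (exp L)" by simp
  have half: "norm (-1/2 :: complex) \<le> 1/2" "norm (1/2 :: complex) \<le> 1/2" by simp_all
  define y where "y = 16 * exp (- 2 * L)"
  have y: "norm y < 1"
  proof -
    have "8 ^ 2 < norm (exp L) ^ 2" using L by (intro power_strict_mono) auto
    moreover have "norm y * norm (exp L) ^ 2 = 16"
    proof -
      have "exp (- 2 * L) * exp L ^ 2 = 1"
        by (simp add: power2_eq_square exp_add[symmetric])
      hence "y * exp L ^ 2 = 16" by (simp add: y_def)
      from arg_cong[OF this, of norm] show ?thesis by (simp add: norm_mult norm_power)
    qed
    ultimately show ?thesis
      using mult_right_mono[of 1 "norm y" "norm (exp L) ^ 2"] by (cases "1 \<le> norm y") auto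
  qed
  define q where "q = (\<lambda>N. fps_const (y ^ N) * qjet L N)"
  define q' where "q' = (\<lambda>N. fps_const (exp (- L)) * ((fps_const (1/2) - 2 * (of_nat N + fps_X)) * q N))"
  have q: "gkz_qterm L (1/2) N has_fps_expansion q N" for N
  proof -
    have "(\<lambda>\<tau>. y ^ N * qcoeff L N \<tau>) has_fps_expansion q N"
      unfolding q_def by (intro has_fps_expansion_cmult_left qcoeff_has_fps_expansion)
    thus ?thesis
      by (rule has_fps_expansion_transfer[OF _ zero_less_one]) (simp add: gkz_qterm_half y_def)
  qed
  have q': "gkz_qterm L (-1/2) N has_fps_expansion q' N" for N
  proof -
    have "(\<lambda>\<tau>. exp (- L) * ((1/2 - 2 * (of_nat N + \<tau>)) * gkz_qterm L (1/2) N \<tau>)) has_fps_expansion q' N"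
      unfolding q'_def fps_of_nat[symmetric]
      by (intro has_fps_expansion_cmult_left has_fps_expansion_mult has_fps_expansion_diff has_fps_expansion_add
          has_fps_expansion_const has_fps_expansion_fps_X has_fps_expansion_numeral q)
    thus ?thesis
      by (rule has_fps_expansion_transfer[OF _ zero_less_one]) (rule gkz_qterm_minus_half[symmetric])
  qed
  obtain G H where GH: "(\<lambda>\<epsilon>. gkz_series L (1/2 - 2 * \<epsilon>) \<epsilon> \<epsilon>) has_fps_expansion G"
    "(\<lambda>\<epsilon>. gkz_series L (1/2) \<epsilon> (- \<epsilon>)) has_fps_expansion H"
    "fps_nth H 0 = fps_nth G 0" "fps_nth H 1 = 0"
    "(\<lambda>N. fps_nth (q N) 0) sums fps_nth G 0"
    "(\<lambda>N. fps_nth (q N) 1) sums fps_nth G 1"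
    "(\<lambda>N. fps_nth (q N) 2) sums (fps_nth G 2 - fps_nth H 2)"
    by (rule gkz_series_jets[OF L half(2) q])
  obtain G' H' where GH': "(\<lambda>\<epsilon>. gkz_series L (-1/2 - 2 * \<epsilon>) \<epsilon> \<epsilon>) has_fps_expansion G'"
    "(\<lambda>\<epsilon>. gkz_series L (-1/2) \<epsilon> (- \<epsilon>)) has_fps_expansion H'"
    "fps_nth H' 0 = fps_nth G' 0" "fps_nth H' 1 = 0"
    "(\<lambda>N. fps_nth (q' N) 0) sums fps_nth G' 0"
    "(\<lambda>N. fps_nth (q' N) 1) sums fps_nth G' 1"
    "(\<lambda>N. fps_nth (q' N) 2) sums (fps_nth G' 2 - fps_nth H' 2)"
    by (rule gkz_series_jets[OF L half(1) q'])
  define U where "U = (\<lambda>k. [fps_nth G 0, fps_nth G 1, fps_nth G 2 - fps_nth H 2] ! k)"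
  \<comment> \<open>The factor \<open>exp L\<close> undoes the \<open>exp (-L)\<close> in
    \<open>q'\<close>.\<close>
  define V where "V = (\<lambda>k. exp L * [fps_nth G' 0, fps_nth G' 1, fps_nth G' 2 - fps_nth H' 2] ! k)"
  have k: "k = 0 \<or> k = 1 \<or> k = 2" if "k \<le> 2" for k :: nat
    using that by auto
  have U: "(\<lambda>N. fps_nth (qjet L N) k * y ^ N) sums U k" if "k \<le> 2" for k
  proof -
    have "(\<lambda>N. fps_nth (q N) k) sums U k"
      using k[OF that] GH(5-7) by (auto simp: U_def)
    thus ?thesis by (simp add: q_def mult.commute)
  qed
  have V: "(\<lambda>N. fps_nth ((fps_const (1/2) - 2 * (of_nat N + fps_X)) * qjet L N) k * y ^ N) sums V k"
    if "k \<le> 2" for k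
  proof -
    have "(\<lambda>N. fps_nth (q' N) k) sums (exp (- L) * V k)"
      using k[OF that] GH'(5-7) by (auto simp: V_def mult.assoc[symmetric] exp_minus_inverse exp_add[symmetric])
    hence "(\<lambda>N. exp L * fps_nth (q' N) k) sums (exp L * (exp (- L) * V k))"
      by (rule sums_mult)
    moreover have cancel: "exp L * (exp (- L) * x) = x" for x
      by (simp add: mult.assoc[symmetric] exp_add[symmetric])
    moreover have "exp L * fps_nth (q' N) k =
      fps_nth ((fps_const (1/2) - 2 * (of_nat N + fps_X)) * qjet L N) k * y ^ N" for N
    proof -
      have "q' N = fps_const (exp (- L)) * (fps_const (y ^ N) * ((fps_const (1/2) - 2 * (of_nat N + fps_X)) * qjet L N))"
        by (simp only: q'_def q_def mult_ac)
      thus ?thesis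
        by (simp only: fps_mult_left_const_nth cancel mult.commute)
    qed
    ultimately show ?thesis by (simp only:)
  qed
  have pairing: "U 0 * V 2 - U 1 * V 1 + U 2 * V 0 + 2 * of_real pi ^ 2 * (U 0 * V 0) = 32 * exp L / of_real pi"
    by (rule qjet_pairing[OF y U V])
  define P where "P = (vector [fps_nth G' 0, - fps_nth G' 1, - fps_nth G' 1, 2 * (fps_nth G' 2 - fps_nth H' 2)] :: complex ^ 4)"
  \<comment> \<open>The middle entries have the opposite sign to those of \<open>P\<close>, because
    the first entry of the dual vector is the family at \<open>-\<epsilon>\<close>.\<close>
  define P' where "P' = (vector [fps_nth G 0, fps_nth G 1, fps_nth G 1, 2 * (fps_nth G 2 - fps_nth H 2)] :: complex ^ 4)"
  have neg: "(\<lambda>\<epsilon>. f (- \<epsilon>)) has_fps_expansion Abs_fps (\<lambda>n. (-1) ^ n * fps_nth F n)"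
    if "f has_fps_expansion F" for f :: "complex \<Rightarrow> complex" and F
    using has_fps_expansion_scale_arg[OF that, where c = "-1"] by simp
  have "((\<lambda>\<epsilon>. Phi L \<epsilon> v* Q \<epsilon>) \<longlongrightarrow> P) (at 0)"
  proof -
    have eq: "Phi L \<epsilon> = vector [gkz_series L (-1/2 - 2 * \<epsilon>) \<epsilon> \<epsilon>, gkz_series L (-1/2) (- \<epsilon>) (- (- \<epsilon>)),
      gkz_series L (-1/2) (- \<epsilon>) (- (- \<epsilon>)), gkz_series L (-1/2 - 2 * - \<epsilon>) (- \<epsilon>) (- \<epsilon>)]" for \<epsilon>
      by (simp add: Phi_def phi345_c_def phi245_c_def phi134_c_def phi124_c_def)
    define F2 where "F2 = Abs_fps (\<lambda>n. (-1) ^ n * fps_nth H' n)"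
    define F4 where "F4 = Abs_fps (\<lambda>n. (-1) ^ n * fps_nth G' n)"
    have P: "P = vector [fps_nth G' 0, - fps_nth G' 1, - fps_nth G' 1, fps_nth G' 2 - 2 * fps_nth F2 2 + fps_nth F4 2]"
      by (simp add: P_def F2_def F4_def)
    show ?thesis
      unfolding eq P
      by (rule vector_matrix_mult_Q_tendsto[OF GH'(1) neg[OF GH'(2), folded F2_def] neg[OF GH'(1), folded F4_def]])
        (use GH'(3,4) in \<open>simp_all add: F2_def F4_def\<close>)
  qed
  moreover have "((\<lambda>\<epsilon>. Phi_dual L \<epsilon> v* Q \<epsilon>) \<longlongrightarrow> P') (at 0)"
  proof -
    have eq: "Phi_dual L \<epsilon> = vector [gkz_series L (1/2 - 2 * - \<epsilon>) (- \<epsilon>) (- \<epsilon>), gkz_series L (1/2) \<epsilon> (- \<epsilon>),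
      gkz_series L (1/2) \<epsilon> (- \<epsilon>), gkz_series L (1/2 - 2 * \<epsilon>) \<epsilon> \<epsilon>]" for \<epsilon>
      by (simp add: Phi_dual_def phi345_mc_def phi245_mc_def phi134_mc_def phi124_mc_def)
    define F1 where "F1 = Abs_fps (\<lambda>n. (-1) ^ n * fps_nth G n)"
    have P': "P' = vector [fps_nth F1 0, - fps_nth F1 1, - fps_nth F1 1, fps_nth F1 2 - 2 * fps_nth H 2 + fps_nth G 2]"
      by (simp add: P'_def F1_def)
    show ?thesis
      unfolding eq P'
      by (rule vector_matrix_mult_Q_tendsto[OF neg[OF GH(1), folded F1_def] GH(2) GH(1)])
        (use GH(3,4) in \<open>simp_all add: F1_def\<close>)
  qed
  moreover have "(rowvector P :: complex ^ 4 ^ 1) ** pairing_matrix ** transpose (rowvector P' :: complex ^ 4 ^ 1) = mat 64"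
  proof -
    define x0 x1 x2 where "x0 = fps_nth G 0" and "x1 = fps_nth G 1" and "x2 = fps_nth G 2 - fps_nth H 2"
    define x0' x1' x2' where "x0' = fps_nth G' 0" and "x1' = fps_nth G' 1" and "x2' = fps_nth G' 2 - fps_nth H' 2"
    define p where "p = complex_of_real pi"
    have p: "p \<noteq> 0" by (simp add: p_def)
    have "exp L * ((x0 * x2' - x1 * x1' + x2 * x0' + 2 * p ^ 2 * (x0 * x0')) * p) = exp L * 32"
      using pairing p by (simp add: U_def V_def x0_def x1_def x2_def x0'_def x1'_def x2'_def p_def field_simps)
    hence "(x0 * x2' - x1 * x1' + x2 * x0' + 2 * p ^ 2 * (x0 * x0')) * p = 32"
      by simp
    \<comment> \<open>The matrix product is \<open>2\<pi>\<close> times the polarized form with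
      \<open>\<kappa> = 2\<pi>^2\<close>; this accounts for the corner entry
      \<open>4\<pi>^3\<close>.\<close>
    moreover have "4 * p ^ 3 * x0' * x0 + p * (x0' * (2 * x2) + 2 * (- x1') * x1 + (2 * x2') * x0) =
        2 * ((x0 * x2' - x1 * x1' + x2 * x0' + 2 * p ^ 2 * (x0 * x0')) * p)"
      by (simp add: algebra_simps power2_eq_square power3_eq_cube)
    ultimately have "4 * p ^ 3 * x0' * x0 + p * (x0' * (2 * x2) + 2 * (- x1') * x1 + (2 * x2') * x0) = 64"
      by simp
    thus ?thesis
      using pairing_matrix_product[OF P_def P'_def]
      by (simp only: x0_def x1_def x2_def x0'_def x1'_def x2'_def p_def)
  qed
  moreover have "\<forall>\<^sub>F \<epsilon> in at 0. all_series_converge L \<epsilon>"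
  proof -
    have "all_series_converge L \<epsilon>" if "norm \<epsilon> \<le> 1/8" for \<epsilon>
      unfolding all_series_converge_def
      using that by (intro conjI gkz_term_summable[OF L half(1)] gkz_term_summable[OF L half(2)]) simp_all
    thus ?thesis
      using eventually_nhds_0_norm_le[of "1/8"] by (auto simp: eventually_at_filter elim!: eventually_mono)
  qed
  ultimately show "(\<forall>\<^sub>F \<epsilon> in at 0. all_series_converge L \<epsilon>) \<and>
    (\<exists>P P' :: complex ^ 4.
       ((\<lambda>\<epsilon>. Phi L \<epsilon> v* Q \<epsilon>) \<longlongrightarrow> P) (at 0) \<and>
       ((\<lambda>\<epsilon>. Phi_dual L \<epsilon> v* Q \<epsilon>) \<longlongrightarrow> P') (at 0) \<and>
       (rowvector P :: complex ^ 4 ^ 1) ** pairing_matrix ** transpose (rowvector P' :: complex ^ 4 ^ 1) = mat 64)"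
    by blast
qed

end
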